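(* Given a database $D$, a finite predicate space $\mathcal P$, an influence function $\mathrm{Inf}$ with sensitivity $\Delta_{\mathrm{Inf}}$, explanation predicates $p_1,\dots,p_k\in\mathcal P$, a confidence level $\gamma\in(0,1)$ and a privacy parameter $\rho_{Rank}>0$, the noisy binary search mechanism (described in the context) returns intervals $\mathcal I_1,\dots,\mathcal I_k$ such that: (1) the noisy binary search mechanism satisfies $\rho_{Rank}$-zCDP; (2) for every $u\in\{1,\dots,k\}$, $\mathcal I_u=(\mathcal I_u^L,\mathcal I_u^U)$ is a $\gamma$-level confidence interval of $\mathrm{rank}(p_u)$, i.e. $\Pr[\mathcal I_u^L\le\mathrm{rank}(p_u)\le\mathcal I_u^U]\ge\gamma$.
   Context: A database is a finite bag of tuples; $D\approx D'$ (neighboring) if one is obtained from the other by adding or removing one tuple. A randomized mechanism $\mathcal M$ is $\rho$-zCDP if $D_\alpha(\mathcal M(D)\|\mathcal M(D'))\le\rho\alpha$ for all $D\approx D'$ and all $\alpha\in(1,\infty)$, where $D_\alpha$ is Rényi divergence of order $\alpha$. An influence function assigns to each $p\in\mathcal P$ and database $D$ a real number $\mathrm{Inf}(p;D)$ (written $\mathrm{Inf}(p)$ when $D$ is fixed); it has sensitivity $\Delta_{\mathrm{Inf}}>0$ if $|\mathrm{Inf}(p;D)-\mathrm{Inf}(p;D')|\le\Delta_{\mathrm{Inf}}$ for all $p\in\mathcal P$ and $D\approx D'$. $\mathrm{rank}(p)\in\{1,\dots,|\mathcal P|\}$ is the position of $p$ when $\mathcal P$ is sorted in descending order of $\mathrm{Inf}(\cdot;D)$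 (ties broken by a fixed order), and $\mathrm{rank}^{-1}(t)$ is the predicate in position $t$. **Noisy binary search mechanism** (with a fixed parameter $\eta\in(0,1)$). Put $\rho=\rho_{Rank}/k$, $\beta=(\gamma+1)/2$. For each $u$ output $\mathcal I_u=\big(\mathrm{RankBound}(p_u,\eta\rho,\beta,-1),\ \mathrm{RankBound}(p_u,(1-\eta)\rho,\beta,+1)\big)$, all calls using independent noise. The subroutine $\mathrm{RankBound}(p,\rho,\beta,dir)$ is: let $N=\lceil\log_2|\mathcal P|\rceil$, $\sigma=2\Delta_{\mathrm{Inf}}/\sqrt{2(\rho/N)}$, $\xi=\sigma\sqrt{2\ln(N/(1-\beta))}\cdot dir$. Initialize $t_{low}=1$, $t_{high}=|\mathcal P|$. While $t_{high}>t_{low}$: let $t=\lfloor(t_{high}+t_{low})/2\rfloor$, draw $\hat s=\mathrm{Inf}(p)-\mathrm{Inf}(\mathrm{rank}^{-1}(t))+N(0,\sigma^2)$ with fresh Gaussian noise; if $\hat s\ge\xi$ set $t_{high}=\max\{t-1,1\}$, otherwise set $t_{low}=\min\{t+1,|\mathcal P|\}$. When $t_{high}\le t_{low}$, stop and return $t_{high}$. (If $|\mathcal P|=1$ no iteration is performed.) *)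

theory Defs
  imports "HOL-Probability.Probability" "HOL-Library.Multiset"
begin

section \<open>Zero-concentrated differential privacy\<close>

definition neighboring :: "'a multiset \<Rightarrow> 'a multiset \<Rightarrow> bool" where
  "neighboring D D' \<longleftrightarrow> (\<exists>x. D' = add_mset x D \<or> D = add_mset x D')"

text \<open>
  \<open>renyi_divergence \<alpha> P Q\<close> is the order-\<open>\<alpha>\<close> divergence of \<open>P\<close> from \<open>Q\<close> for \<open>\<alpha> > 1\<close>, with the
  natural logarithm:
  \<open>1 / (\<alpha> - 1) * ln (\<integral> (dP/dQ)\<^sup>\<alpha> dQ)\<close>, and \<open>\<infinity>\<close> if \<open>P\<close> is not absolutely continuous with respect
  to \<open>Q\<close>. Note the argument order of the library: \<open>RN_deriv Q P\<close> is \<open>dP/dQ\<close>, and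
  \<open>absolutely_continuous Q P\<close> says that every \<open>Q\<close>-null set is a \<open>P\<close>-null set.
\<close>
definition renyi_divergence :: "real \<Rightarrow> 'b measure \<Rightarrow> 'b measure \<Rightarrow> ereal" where
  "renyi_divergence \<alpha> P Q =
    (if absolutely_continuous Q P
     then let I = (\<integral>\<^sup>+ x. ennreal (enn2real (RN_deriv Q P x) powr \<alpha>) \<partial>Q)
          in if I = \<infinity> then \<infinity> else ereal (1 / (\<alpha> - 1) * ln (enn2real I))
     else \<infinity>)"

text \<open>
  A randomized mechanism with outputs in the measurable space \<open>S\<close> maps each database to its output
  distribution, a probability measure on \<open>S\<close>.
\<close>
definition zCDP :: "'b measure \<Rightarrow> real \<Rightarrow> ('a multiset \<Rightarrow> 'b measure) \<Rightarrow> bool" where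
  "zCDP S \<rho> M \<longleftrightarrow>
    (\<forall>D. M D \<in> space (prob_algebra S)) \<and>
    (\<forall>D D' \<alpha>. neighboring D D' \<longrightarrow> 1 < \<alpha> \<longrightarrow>
       renyi_divergence \<alpha> (M D) (M D') \<le> ereal (\<rho> * \<alpha>))"

section \<open>Influence and rank\<close>

definition has_sensitivity :: "'p set \<Rightarrow> ('p \<Rightarrow> 'a multiset \<Rightarrow> real) \<Rightarrow> real \<Rightarrow> bool" where
  "has_sensitivity Preds infl \<Delta> \<longleftrightarrow>
    0 < \<Delta> \<and> (\<forall>p\<in>Preds. \<forall>D D'. neighboring D D' \<longrightarrow> \<bar>infl p D - infl p D'\<bar> \<le> \<Delta>)"

text \<open>
  \<open>tie\<close> is the fixed order used to break ties; \<open>(p, q) \<in> tie\<close> puts \<open>p\<close> before \<open>q\<close>. It is meant to be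
  a linear order on \<open>Preds\<close>.
\<close>
definition ranked_before ::
    "'p rel \<Rightarrow> ('p \<Rightarrow> 'a multiset \<Rightarrow> real) \<Rightarrow> 'a multiset \<Rightarrow> 'p \<Rightarrow> 'p \<Rightarrow> bool" where
  "ranked_before tie infl D p q \<longleftrightarrow>
    infl q D < infl p D \<or> (infl p D = infl q D \<and> p \<noteq> q \<and> (p, q) \<in> tie)"

definition ranking ::
    "'p set \<Rightarrow> 'p rel \<Rightarrow> ('p \<Rightarrow> 'a multiset \<Rightarrow> real) \<Rightarrow> 'a multiset \<Rightarrow> 'p list" where
  "ranking Preds tie infl D =
    (THE ps. distinct ps \<and> set ps = Preds \<and> sorted_wrt (ranked_before tie infl D) ps)"

text \<open>Positions are counted from 1.\<close>
definition infl_rank_inv ::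
    "'p set \<Rightarrow> 'p rel \<Rightarrow> ('p \<Rightarrow> 'a multiset \<Rightarrow> real) \<Rightarrow> 'a multiset \<Rightarrow> nat \<Rightarrow> 'p" where
  "infl_rank_inv Preds tie infl D t = ranking Preds tie infl D ! (t - 1)"

definition infl_rank ::
    "'p set \<Rightarrow> 'p rel \<Rightarrow> ('p \<Rightarrow> 'a multiset \<Rightarrow> real) \<Rightarrow> 'a multiset \<Rightarrow> 'p \<Rightarrow> nat" where
  "infl_rank Preds tie infl D p = (THE t. t \<in> {1..card Preds} \<and> infl_rank_inv Preds tie infl D t = p)"

lemma ranking_ex1:
  assumes "finite Preds" "linear_order_on Preds tie"
  shows "\<exists>!ps. distinct ps \<and> set ps = Preds \<and> sorted_wrt (ranked_before tie infl D) ps"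
proof -
  let ?R = "ranked_before tie infl D"
  have tr: "trans tie" and an: "antisym tie" and tot: "total_on Preds tie"
    using assms(2) by (auto simp: order_on_defs)
  have R_trans: "?R p r" if "?R p q" "?R q r" for p q r
    using that transD[OF tr, of p q r] antisymD[OF an, of p q] unfolding ranked_before_def by auto
  have R_irrefl: "\<not> ?R p p" for p
    by (simp add: ranked_before_def)
  have R_total: "?R p q \<or> ?R q p" if "p \<in> Preds" "q \<in> Preds" "p \<noteq> q" for p q
    using that tot unfolding ranked_before_def total_on_def by (metis linorder_less_linear)
  have ex: "\<exists>ps. distinct ps \<and> set ps = A \<and> sorted_wrt ?R ps" if "finite A" "A \<subseteq> Preds" for A
    using that
  proof (induction A rule: finite_induct)
    case empty
    show ?case by (intro exI[of _ "[]"]) simp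
  next
    case (insert x A)
    then obtain ps where ps: "distinct ps" "set ps = A" "sorted_wrt ?R ps" by auto
    let ?qs = "filter (\<lambda>y. ?R y x) ps @ x # filter (\<lambda>y. ?R x y) ps"
    have set: "set ?qs = insert x A"
      using ps insert R_total[of x] by auto
    have disj: "{y. ?R y x} \<inter> {y. ?R x y} = {}"
      using R_trans[of _ x] R_irrefl by blast
    have dist: "distinct ?qs"
      using ps(1,2) insert.hyps disj by auto
    have sorted: "sorted_wrt ?R ?qs"
      using ps R_trans[of _ x] by (simp add: sorted_wrt_append sorted_wrt_filter)
    show ?case using set dist sorted by blast
  qed
  have uniq: "ps = qs" if "distinct ps" "sorted_wrt ?R ps" "distinct qs"
    "sorted_wrt ?R qs" "set ps = set qs" for ps qs
    using that
  proof (induction ps arbitrary: qs)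
    case Nil
    then show ?case by simp
  next
    case (Cons x ps)
    then obtain y qs' where qs: "qs = y # qs'" by (cases qs) auto
    have "x = y"
    proof (rule ccontr)
      assume "x \<noteq> y"
      then have "?R x y" "?R y x" using Cons.prems qs by auto
      then show False using R_trans[of x y x] R_irrefl by simp
    qed
    moreover from this have "set ps = set qs'"
      using Cons.prems qs by (auto simp: insert_ident)
    ultimately show ?case using Cons.IH[of qs'] Cons.prems qs by auto
  qed
  show ?thesis
    using ex[OF assms(1)] uniq by (intro ex_ex1I) auto
qed

section \<open>Noisy binary search\<close>

text \<open>
  \<open>rank_bound_loop n \<sigma> \<xi> d t_low t_high\<close> is the distribution of the value returned by the while loop
  started at \<open>(t_low, t_high)\<close>, where \<open>n\<close> is the number of predicates and \<open>d t\<close> is the exact value of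
  the query at position \<open>t\<close>. The loop need not terminate outside the range
  \<open>1 \<le> t_low\<close>, \<open>t_high \<le> n\<close>, which it never leaves; inside it the equation below holds
  unconditionally, see \<open>rank_bound_loop_eq\<close>.
\<close>
function (domintros) rank_bound_loop ::
    "nat \<Rightarrow> real \<Rightarrow> real \<Rightarrow> (nat \<Rightarrow> real) \<Rightarrow> nat \<Rightarrow> nat \<Rightarrow> nat measure" where
  "rank_bound_loop n \<sigma> \<xi> d t_low t_high =
    (if t_low < t_high
     then let t = (t_high + t_low) div 2
          in density lborel (normal_density 0 \<sigma>) \<bind>
               (\<lambda>z. if \<xi> \<le> d t + z
                    then rank_bound_loop n \<sigma> \<xi> d t_low (max (t - 1) 1)
                    else rank_bound_loop n \<sigma> \<xi> d (min (t + 1) n) t_high)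
     else return (count_space UNIV) t_high)"
  by pat_completeness auto

lemma rank_bound_loop_dom:
  assumes "1 \<le> t_low" "t_high \<le> n"
  shows "rank_bound_loop_dom (n, \<sigma>, \<xi>, d, t_low, t_high)"
  using assms
proof (induction "t_high - t_low" arbitrary: t_low t_high rule: less_induct)
  case less
  show ?case
  proof (rule rank_bound_loop.domintros)
    assume *: "t_low < t_high"
    define t where "t = (t_high + t_low) div 2"
    have t: "t_low \<le> t" "t < t_high" "1 \<le> t" "t + 1 \<le> n"
      using * less.prems by (auto simp: t_def)
      have "max (t - 1) 1 - t_low < t_high - t_low" "max (t - 1) 1 \<le> n"
        using * t less.prems by auto
      then show "rank_bound_loop_dom
          (n, \<sigma>, \<xi>, d, t_low, max ((t_high + t_low) div 2 - Suc 0) (Suc 0))"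
        using less.hyps less.prems unfolding t_def by simp
      have "t_high - min (t + 1) n < t_high - t_low" "1 \<le> min (t + 1) n"
        using * t less.prems by auto
      then show "rank_bound_loop_dom
          (n, \<sigma>, \<xi>, d, min (Suc ((t_high + t_low) div 2)) n, t_high)"
        using less.hyps less.prems unfolding t_def by simp
  qed
qed

lemmas rank_bound_loop_eq = rank_bound_loop.psimps[OF rank_bound_loop_dom]

text \<open>
  If there is only one predicate, then \<open>N = 0\<close> and \<open>\<sigma>\<close>, \<open>\<xi>\<close> are meaningless, but the loop is not
  entered and they are not used.
\<close>
definition rank_bound ::
    "'p set \<Rightarrow> 'p rel \<Rightarrow> ('p \<Rightarrow> 'a multiset \<Rightarrow> real) \<Rightarrow> real \<Rightarrow> 'a multiset \<Rightarrow>
     'p \<Rightarrow> real \<Rightarrow> real \<Rightarrow> real \<Rightarrow> nat measure" where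
  "rank_bound Preds tie infl \<Delta> D p \<rho> \<beta> dir =
    (let N = real_of_int \<lceil>log 2 (card Preds)\<rceil>;
         \<sigma> = 2 * \<Delta> / sqrt (2 * (\<rho> / N));
         \<xi> = \<sigma> * sqrt (2 * ln (N / (1 - \<beta>))) * dir
     in rank_bound_loop (card Preds) \<sigma> \<xi> (\<lambda>t. infl p D - infl (infl_rank_inv Preds tie infl D t) D)
          1 (card Preds))"

text \<open>
  The output of the mechanism is the family of pairs \<open>(I\<^sup>L u, I\<^sup>U u)\<close> for \<open>u \<in> {1..k}\<close>; the product
  measures express that the \<open>2 * k\<close> calls use independent noise.
\<close>
definition interval_space :: "nat \<Rightarrow> (nat \<Rightarrow> nat \<times> nat) measure" where
  "interval_space k = PiM {1..k} (\<lambda>_. count_space UNIV \<Otimes>\<^sub>M count_space UNIV)"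

definition noisy_binary_search ::
    "'p set \<Rightarrow> 'p rel \<Rightarrow> ('p \<Rightarrow> 'a multiset \<Rightarrow> real) \<Rightarrow> real \<Rightarrow> real \<Rightarrow>
     nat \<Rightarrow> (nat \<Rightarrow> 'p) \<Rightarrow> real \<Rightarrow> real \<Rightarrow> 'a multiset \<Rightarrow> (nat \<Rightarrow> nat \<times> nat) measure" where
  "noisy_binary_search Preds tie infl \<Delta> \<eta> k p \<gamma> \<rho>_rank D =
    (let \<rho> = \<rho>_rank / k; \<beta> = (\<gamma> + 1) / 2
     in PiM {1..k} (\<lambda>u.
          rank_bound Preds tie infl \<Delta> D (p u) (\<eta> * \<rho>) \<beta> (- 1) \<Otimes>\<^sub>M
          rank_bound Preds tie infl \<Delta> D (p u) ((1 - \<eta>) * \<rho>) \<beta> 1))"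

end

theory Submission
  imports Defs
begin

text \<open>
  Privacy. The value at a fixed rank changes by at most \<open>\<Delta>\<close> between neighboring databases, so every
  query has sensitivity \<open>2 * \<Delta>\<close>. The function \<open>(u, v) \<mapsto> v * (u / v) powr \<alpha>\<close> is the supremum of the
  linear functions \<open>\<alpha> * c powr (\<alpha> - 1) * u - (\<alpha> - 1) * c powr \<alpha> * v\<close>; integrating the right one over an
  event gives the data processing inequality for a thresholded Gaussian, and superadditivity gives
  the same for mixtures. Hence each iteration multiplies the moment \<open>\<integral> (dP/dQ)\<^sup>\<alpha> dQ\<close> by at most
  \<open>exp (\<alpha> * (\<alpha> - 1) * \<rho> / N)\<close>. The search interval is at least halved, so there are at most \<open>N\<close>
  iterations, and moments multiply over the independent calls.

  Coverage. A search step can only discard the true rank on the relevant side if the noise exceeds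
  the threshold in the direction of the threshold, which by the Gaussian tail bound happens with
  probability at most \<open>(1 - \<beta>) / N\<close>. Summing over the iterations, each endpoint is wrong with
  probability at most \<open>1 - \<beta> = (1 - \<gamma>) / 2\<close>.
\<close>

section \<open>The integrand of the Renyi moment\<close>

text \<open>The perspective of \<open>r powr \<alpha>\<close>; summed or integrated over densities
  it gives the Renyi moment. Division by zero makes it 0 at \<open>v = 0\<close>, so absolute
  continuity appears below as \<open>v = 0 \<Longrightarrow> u = 0\<close>.\<close>

definition renyi_term :: "real \<Rightarrow> real \<Rightarrow> real \<Rightarrow> real" where
  "renyi_term \<alpha> u v = v * (u / v) powr \<alpha>"

text \<open>Young's inequality for \<open>r\<close> and \<open>c powr (\<alpha> - 1)\<close>; the
  left-hand side is the tangent of \<open>r powr \<alpha>\<close> at \<open>c\<close>.\<close>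

lemma powr_ge_tangent:
  fixes r c :: real
  assumes "1 < \<alpha>" "0 \<le> r" "0 \<le> c"
  shows "\<alpha> * c powr (\<alpha> - 1) * r - (\<alpha> - 1) * c powr \<alpha> \<le> r powr \<alpha>"
proof -
  have "r * c powr (\<alpha> - 1) \<le> r powr \<alpha> / \<alpha> + (c powr (\<alpha> - 1)) powr (\<alpha> / (\<alpha> - 1)) / (\<alpha> / (\<alpha> - 1))"
    using assms by (intro Youngs_inequality) (auto simp: field_simps)
  also have "(c powr (\<alpha> - 1)) powr (\<alpha> / (\<alpha> - 1)) = c powr \<alpha>"
    using assms by (simp add: powr_powr)
  finally show ?thesis
    using assms by (simp add: field_simps)
qed

text \<open>The tangent inequality at \<open>r = u / v\<close>, scaled by \<open>v\<close>. For
  fixed \<open>c\<close> the bound is linear in \<open>u\<close> and \<open>v\<close>, so it can be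
  added and integrated.\<close>

lemma renyi_term_ge_tangent:
  assumes "1 < \<alpha>" "0 \<le> u" "0 \<le> v" "v = 0 \<Longrightarrow> u = 0" "0 \<le> c"
  shows "\<alpha> * c powr (\<alpha> - 1) * u - (\<alpha> - 1) * c powr \<alpha> * v \<le> renyi_term \<alpha> u v"
proof (cases "v = 0")
  case True
  then show ?thesis using assms by (simp add: renyi_term_def)
next
  case False
  then have "v * (\<alpha> * c powr (\<alpha> - 1) * (u / v) - (\<alpha> - 1) * c powr \<alpha>) \<le> v * (u / v) powr \<alpha>"
    using assms by (intro mult_left_mono powr_ge_tangent) auto
  moreover have "v * (a * (u / v) - b) = a * u - b * v" for a b
    using False by (simp add: right_diff_distrib mult.commute)
  ultimately show ?thesis
    by (simp add: renyi_term_def)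
qed

text \<open>Tangency at \<open>c = u / v\<close>, the choice that makes the preceding bound
  tight.\<close>

lemma renyi_term_eq_tangent:
  assumes "0 \<le> u" "0 \<le> v" "v = 0 \<Longrightarrow> u = 0"
  shows "renyi_term \<alpha> u v
    = \<alpha> * (u / v) powr (\<alpha> - 1) * u - (\<alpha> - 1) * (u / v) powr \<alpha> * v"
proof (cases "u = 0")
  case True
  then show ?thesis by (simp add: renyi_term_def)
next
  case False
  then have "v > 0" "u > 0" using assms by (auto simp: less_le)
  then have "(u / v) powr \<alpha> = (u / v) powr (\<alpha> - 1) * (u / v)"
    by (simp add: powr_diff)
  then have "(u / v) powr \<alpha> * v = (u / v) powr (\<alpha> - 1) * u"
    using \<open>v > 0\<close> by simp
  then show ?thesis
    unfolding renyi_term_def by (simp add: algebra_simps)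
qed

lemma renyi_term_nonneg: "0 \<le> v \<Longrightarrow> 0 \<le> renyi_term \<alpha> u v"
  by (simp add: renyi_term_def)

lemma renyi_term_mult:
  assumes "0 \<le> a" "0 \<le> b" "0 \<le> u" "0 \<le> v"
  shows "renyi_term \<alpha> (a * u) (b * v) = renyi_term \<alpha> a b * renyi_term \<alpha> u v"
  using assms powr_mult[of "a / b" "u / v" \<alpha>] by (simp add: renyi_term_def)

text \<open>One tangent, with \<open>c\<close> the ratio of the sums, is exact for the sums, splits
  linearly, and bounds each summand from below.\<close>

lemma renyi_term_add_le:
  assumes "1 < \<alpha>" "0 \<le> u1" "0 \<le> v1" "0 \<le> u2" "0 \<le> v2"
    and "v1 = 0 \<Longrightarrow> u1 = 0" "v2 = 0 \<Longrightarrow> u2 = 0"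
  shows "renyi_term \<alpha> (u1 + u2) (v1 + v2) \<le> renyi_term \<alpha> u1 v1 + renyi_term \<alpha> u2 v2"
proof -
  define c where "c = (u1 + u2) / (v1 + v2)"
  have "c \<ge> 0" using assms by (simp add: c_def)
  have "renyi_term \<alpha> (u1 + u2) (v1 + v2)
      = \<alpha> * c powr (\<alpha> - 1) * (u1 + u2) - (\<alpha> - 1) * c powr \<alpha> * (v1 + v2)"
    unfolding c_def using assms by (intro renyi_term_eq_tangent) (auto simp: add_nonneg_eq_0_iff)
  also have "\<dots> = (\<alpha> * c powr (\<alpha> - 1) * u1 - (\<alpha> - 1) * c powr \<alpha> * v1)
      + (\<alpha> * c powr (\<alpha> - 1) * u2 - (\<alpha> - 1) * c powr \<alpha> * v2)"
    by (simp add: algebra_simps)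
  also have "\<dots> \<le> renyi_term \<alpha> u1 v1 + renyi_term \<alpha> u2 v2"
    using assms \<open>c \<ge> 0\<close> by (intro add_mono renyi_term_ge_tangent) auto
  finally show ?thesis .
qed

section \<open>Normal distributions\<close>

definition normal_prob :: "real \<Rightarrow> real \<Rightarrow> real set \<Rightarrow> real" where
  "normal_prob \<sigma> x A = (\<integral>z. indicator A z * normal_density x \<sigma> z \<partial>lborel)"

lemma integrable_indicator_normal_density [simp]:
  assumes [measurable]: "A \<in> sets borel" and "0 < \<sigma>"
  shows "integrable lborel (\<lambda>z. indicator A z * normal_density x \<sigma> z)"
  using integrable_real_mult_indicator[of A lborel "normal_density x \<sigma>"] assms
  by (simp add: mult.commute)

lemma normal_prob_nonneg: "0 \<le> normal_prob \<sigma> x A"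
  unfolding normal_prob_def by (intro integral_nonneg_AE) auto

lemma normal_prob_Compl:
  assumes [measurable]: "A \<in> sets borel" and "0 < \<sigma>"
  shows "normal_prob \<sigma> x (- A) = 1 - normal_prob \<sigma> x A"
proof -
  have "normal_prob \<sigma> x (- A) + normal_prob \<sigma> x A
      = (\<integral>z. indicator (- A) z * normal_density x \<sigma> z + indicator A z * normal_density x \<sigma> z \<partial>lborel)"
    using assms unfolding normal_prob_def by (subst Bochner_Integration.integral_add) auto
  also have "\<dots> = (\<integral>z. normal_density x \<sigma> z \<partial>lborel)"
    by (intro Bochner_Integration.integral_cong) (auto simp: indicator_def)
  finally show ?thesis using assms by simp
qed

lemma normal_prob_le_1:
  assumes "A \<in> sets borel" "0 < \<sigma>"
  shows "normal_prob \<sigma> x A \<le> 1"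
  using normal_prob_Compl[OF assms, of x] normal_prob_nonneg[of \<sigma> x "- A"] by simp

text \<open>Translation invariance of Lebesgue measure. The loop adds centred noise to the query
  value \<open>x\<close>; afterwards only Gaussians with different means have to be
  compared.\<close>

lemma normal_prob_eq_prob_shift:
  assumes [measurable]: "A \<in> sets borel" and "0 < \<sigma>"
  shows "measure (density lborel (normal_density 0 \<sigma>)) {z. x + z \<in> A} = normal_prob \<sigma> x A"
proof -
  have [measurable]: "{z. x + z \<in> A} \<in> sets borel" by measurable
  have "emeasure (density lborel (normal_density 0 \<sigma>)) {z. x + z \<in> A}
      = (\<integral>\<^sup>+z. ennreal (normal_density 0 \<sigma> z) * indicator {z. x + z \<in> A} z \<partial>lborel)"
    by (subst emeasure_density) auto
  also have "\<dots> = (\<integral>\<^sup>+z. ennreal (indicator A (x + z) * normal_density x \<sigma> (x + z)) \<partial>lborel)"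
    by (intro nn_integral_cong) (auto simp: indicator_def normal_density_def)
  also have "\<dots> = (\<integral>\<^sup>+z. ennreal (indicator A z * normal_density x \<sigma> z) \<partial>lborel)"
    using nn_integral_real_affine[of "\<lambda>z. ennreal (indicator A z * normal_density x \<sigma> z)" 1 x] by simp
  also have "\<dots> = ennreal (normal_prob \<sigma> x A)"
    unfolding normal_prob_def using assms by (intro nn_integral_eq_integral) auto
  finally show ?thesis
    by (simp add: measure_def normal_prob_nonneg)
qed

text \<open>Completing the square. The integrand of the Gaussian Renyi moment is a constant times a
  Gaussian density with an extrapolated mean, so it can be integrated over any event.\<close>

lemma normal_density_renyi_term:
  assumes "0 < \<sigma>"
  shows "renyi_term \<alpha> (normal_density x \<sigma> z) (normal_density y \<sigma> z)
    = exp (\<alpha> * (\<alpha> - 1) * (x - y)\<^sup>2 / (2 * \<sigma>\<^sup>2)) * normal_density (\<alpha> * x + (1 - \<alpha>) * y) \<sigma> z"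
proof -
  have "normal_density x \<sigma> z / normal_density y \<sigma> z
      = exp ((z - y)\<^sup>2 / (2 * \<sigma>\<^sup>2) - (z - x)\<^sup>2 / (2 * \<sigma>\<^sup>2))"
    using assms by (simp add: normal_density_def exp_diff exp_minus inverse_eq_divide)
  then have powr_eq: "(normal_density x \<sigma> z / normal_density y \<sigma> z) powr \<alpha>
      = exp (\<alpha> * ((z - y)\<^sup>2 / (2 * \<sigma>\<^sup>2) - (z - x)\<^sup>2 / (2 * \<sigma>\<^sup>2)))"
    by (simp add: powr_def)
  then have "renyi_term \<alpha> (normal_density x \<sigma> z) (normal_density y \<sigma> z)
     = 1 / sqrt (2 * pi * \<sigma>\<^sup>2) * exp (- (z - y)\<^sup>2 / (2 * \<sigma>\<^sup>2)
         + \<alpha> * ((z - y)\<^sup>2 / (2 * \<sigma>\<^sup>2) - (z - x)\<^sup>2 / (2 * \<sigma>\<^sup>2)))"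
    unfolding renyi_term_def powr_eq by (simp only: normal_density_def exp_add mult.assoc)
  also have "- (z - y)\<^sup>2 / (2 * \<sigma>\<^sup>2) + \<alpha> * ((z - y)\<^sup>2 / (2 * \<sigma>\<^sup>2) - (z - x)\<^sup>2 / (2 * \<sigma>\<^sup>2))
     = (- (z - y)\<^sup>2 + \<alpha> * ((z - y)\<^sup>2 - (z - x)\<^sup>2)) / (2 * \<sigma>\<^sup>2)"
    by (simp add: diff_divide_distrib add_divide_distrib right_diff_distrib)
  also have "- (z - y)\<^sup>2 + \<alpha> * ((z - y)\<^sup>2 - (z - x)\<^sup>2)
     = \<alpha> * (\<alpha> - 1) * (x - y)\<^sup>2 - (z - (\<alpha> * x + (1 - \<alpha>) * y))\<^sup>2"
    by (simp add: power2_eq_square algebra_simps)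
  also have "(\<alpha> * (\<alpha> - 1) * (x - y)\<^sup>2 - (z - (\<alpha> * x + (1 - \<alpha>) * y))\<^sup>2) / (2 * \<sigma>\<^sup>2)
     = \<alpha> * (\<alpha> - 1) * (x - y)\<^sup>2 / (2 * \<sigma>\<^sup>2) + - (z - (\<alpha> * x + (1 - \<alpha>) * y))\<^sup>2 / (2 * \<sigma>\<^sup>2)"
    by (simp add: diff_divide_distrib)
  finally show ?thesis
    by (simp only: normal_density_def exp_add mult_ac)
qed

lemma normal_prob_pos:
  assumes [measurable]: "A \<in> sets borel" and "0 < \<sigma>" and "emeasure lborel A \<noteq> 0"
  shows "0 < normal_prob \<sigma> x A"
proof (rule ccontr)
  assume "\<not> ?thesis"
  then have "normal_prob \<sigma> x A = 0" using normal_prob_nonneg[of \<sigma> x A] by simp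
  then have "AE z in lborel. indicator A z * normal_density x \<sigma> z = 0"
    unfolding normal_prob_def using assms
    by (subst (asm) integral_nonneg_eq_0_iff_AE) auto
  then have "AE z in lborel. z \<notin> A"
  proof eventually_elim
    case (elim z)
    then show ?case
      using normal_density_pos[OF \<open>0 < \<sigma>\<close>, of x z] by (auto simp: indicator_def)
  qed
  then show False
    using assms(3) by (simp add: AE_iff_measurable[OF _ refl])
qed

text \<open>The tangent with \<open>c\<close> the ratio of the two event probabilities is exact for
  these probabilities and a pointwise lower bound for the densities; it is integrated over
  \<open>A\<close>.\<close>

lemma renyi_term_normal_prob_le:
  assumes [measurable]: "A \<in> sets borel" and "0 < \<sigma>" "1 < \<alpha>" "normal_prob \<sigma> y A \<noteq> 0"
  shows "renyi_term \<alpha> (normal_prob \<sigma> x A) (normal_prob \<sigma> y A)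
    \<le> exp (\<alpha> * (\<alpha> - 1) * (x - y)\<^sup>2 / (2 * \<sigma>\<^sup>2)) * normal_prob \<sigma> (\<alpha> * x + (1 - \<alpha>) * y) A"
proof -
  define c where "c = normal_prob \<sigma> x A / normal_prob \<sigma> y A"
  have "c \<ge> 0" by (simp add: c_def normal_prob_nonneg)
  define s t where "s = \<alpha> * c powr (\<alpha> - 1)" and "t = (\<alpha> - 1) * c powr \<alpha>"
  define E where "E = exp (\<alpha> * (\<alpha> - 1) * (x - y)\<^sup>2 / (2 * \<sigma>\<^sup>2))"
  define m where "m = \<alpha> * x + (1 - \<alpha>) * y"
  have "renyi_term \<alpha> (normal_prob \<sigma> x A) (normal_prob \<sigma> y A)
      = s * normal_prob \<sigma> x A - t * normal_prob \<sigma> y A"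
    unfolding s_def t_def c_def using assms
    by (intro renyi_term_eq_tangent) (auto simp: normal_prob_nonneg)
  also have "\<dots> = (\<integral>z. s * (indicator A z * normal_density x \<sigma> z)
      - t * (indicator A z * normal_density y \<sigma> z) \<partial>lborel)"
    unfolding normal_prob_def using assms by (subst Bochner_Integration.integral_diff) auto
  also have "\<dots> \<le> (\<integral>z. E * (indicator A z * normal_density m \<sigma> z) \<partial>lborel)"
  proof (rule integral_mono)
    fix z
    have "s * normal_density x \<sigma> z - t * normal_density y \<sigma> z
        \<le> renyi_term \<alpha> (normal_density x \<sigma> z) (normal_density y \<sigma> z)"
      unfolding s_def t_def using assms \<open>c \<ge> 0\<close> normal_density_pos[OF \<open>0 < \<sigma>\<close>, of y z]
      by (intro renyi_term_ge_tangent) auto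
    then show "s * (indicator A z * normal_density x \<sigma> z) - t * (indicator A z * normal_density y \<sigma> z)
        \<le> E * (indicator A z * normal_density m \<sigma> z)"
      using normal_density_renyi_term[OF \<open>0 < \<sigma>\<close>, of \<alpha> x z y] by (auto simp: indicator_def E_def m_def)
  qed (use assms in auto)
  also have "\<dots> = E * normal_prob \<sigma> m A"
    unfolding normal_prob_def using assms by simp
  finally show ?thesis unfolding E_def m_def .
qed

text \<open>Comparison with the density centred at \<open>\<xi>\<close>: on \<open>A\<close> the
  quotient of the two densities is at most the stated exponential. The hypothesis covers both tails,
  since it puts \<open>A\<close> beyond \<open>\<xi>\<close> as seen from 0 for either sign of
  \<open>\<xi>\<close>.\<close>

lemma normal_prob_tail_le:
  assumes [measurable]: "A \<in> sets borel" and "0 < \<sigma>" and "\<And>z. z \<in> A \<Longrightarrow> 0 \<le> \<xi> * (z - \<xi>)"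
  shows "normal_prob \<sigma> 0 A \<le> exp (- \<xi>\<^sup>2 / (2 * \<sigma>\<^sup>2))"
proof -
  have "normal_prob \<sigma> 0 A \<le> (\<integral>z. exp (- \<xi>\<^sup>2 / (2 * \<sigma>\<^sup>2)) * (indicator A z * normal_density \<xi> \<sigma> z) \<partial>lborel)"
    unfolding normal_prob_def
  proof (rule integral_mono)
    fix z
    have "normal_density 0 \<sigma> z \<le> exp (- \<xi>\<^sup>2 / (2 * \<sigma>\<^sup>2)) * normal_density \<xi> \<sigma> z" if "z \<in> A"
    proof -
      have "- z\<^sup>2 \<le> - \<xi>\<^sup>2 - (z - \<xi>)\<^sup>2"
        using assms(3)[OF that] by (simp add: power2_eq_square algebra_simps)
      then have "- z\<^sup>2 / (2 * \<sigma>\<^sup>2) \<le> (- \<xi>\<^sup>2 - (z - \<xi>)\<^sup>2) / (2 * \<sigma>\<^sup>2)"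
        by (rule divide_right_mono) simp
      then have "- z\<^sup>2 / (2 * \<sigma>\<^sup>2) \<le> - \<xi>\<^sup>2 / (2 * \<sigma>\<^sup>2) + - (z - \<xi>)\<^sup>2 / (2 * \<sigma>\<^sup>2)"
        by (simp add: diff_divide_distrib)
      then have "exp (- z\<^sup>2 / (2 * \<sigma>\<^sup>2)) \<le> exp (- \<xi>\<^sup>2 / (2 * \<sigma>\<^sup>2)) * exp (- (z - \<xi>)\<^sup>2 / (2 * \<sigma>\<^sup>2))"
        by (simp add: exp_add[symmetric])
      then have "1 / sqrt (2 * pi * \<sigma>\<^sup>2) * exp (- z\<^sup>2 / (2 * \<sigma>\<^sup>2))
          \<le> 1 / sqrt (2 * pi * \<sigma>\<^sup>2) * (exp (- \<xi>\<^sup>2 / (2 * \<sigma>\<^sup>2)) * exp (- (z - \<xi>)\<^sup>2 / (2 * \<sigma>\<^sup>2)))"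
        by (rule mult_left_mono) simp
      then show ?thesis
        unfolding normal_density_def by (simp add: mult_ac)
    qed
    then show "indicator A z * normal_density 0 \<sigma> z
        \<le> exp (- \<xi>\<^sup>2 / (2 * \<sigma>\<^sup>2)) * (indicator A z * normal_density \<xi> \<sigma> z)"
      by (auto simp: indicator_def)
  qed (use assms in auto)
  also have "\<dots> = exp (- \<xi>\<^sup>2 / (2 * \<sigma>\<^sup>2)) * normal_prob \<sigma> \<xi> A"
    unfolding normal_prob_def using assms by simp
  also have "\<dots> \<le> exp (- \<xi>\<^sup>2 / (2 * \<sigma>\<^sup>2)) * 1"
    using assms by (intro mult_left_mono normal_prob_le_1) auto
  finally show ?thesis by simp
qed

section \<open>The binary search loop\<close>

definition mix_pmf :: "real \<Rightarrow> 'a pmf \<Rightarrow> 'a pmf \<Rightarrow> 'a pmf" where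
  "mix_pmf a P Q = bernoulli_pmf a \<bind> (\<lambda>b. if b then P else Q)"

lemma pmf_mix:
  assumes "0 \<le> a" "a \<le> 1"
  shows "pmf (mix_pmf a P Q) x = a * pmf P x + (1 - a) * pmf Q x"
  using assms by (simp add: mix_pmf_def pmf_bind)

lemma set_pmf_mix:
  assumes "0 < a" "a < 1"
  shows "set_pmf (mix_pmf a P Q) = set_pmf P \<union> set_pmf Q"
  using assms by (simp add: mix_pmf_def UNIV_bool Un_commute)

lemma emeasure_mix:
  assumes "0 \<le> a" "a \<le> 1"
  shows "emeasure (mix_pmf a P Q) X = ennreal a * emeasure P X + ennreal (1 - a) * emeasure Q X"
  using assms by (simp add: mix_pmf_def emeasure_bind_pmf mult.commute)

lemma measure_mix:
  assumes "0 \<le> a" "a \<le> 1"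
  shows "measure (mix_pmf a P Q) X = a * measure P X + (1 - a) * measure Q X"
proof -
  have "ennreal (measure (mix_pmf a P Q) X) = ennreal (a * measure P X + (1 - a) * measure Q X)"
    using emeasure_mix[OF assms, of P Q X] assms
    by (simp add: measure_pmf.emeasure_eq_measure ennreal_plus ennreal_mult')
  then show ?thesis
    using assms by (subst (asm) ennreal_inj) auto
qed

text \<open>The continuous noise enters only through the comparison with \<open>\<xi>\<close>, so an
  iteration is a biased coin that chooses a branch. This makes the loop distributions
  discrete.\<close>

lemma normal_threshold_bind:
  assumes "0 < \<sigma>"
  shows "density lborel (normal_density 0 \<sigma>) \<bind>
      (\<lambda>z. if \<xi> \<le> x + z then measure_pmf P else measure_pmf Q)
    = measure_pmf (mix_pmf (normal_prob \<sigma> x {\<xi>..}) P (Q :: 'b pmf))"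
proof (rule measure_eqI)
  let ?N = "density lborel (normal_density 0 \<sigma>)"
  let ?f = "\<lambda>z. if \<xi> \<le> x + z then measure_pmf P else measure_pmf Q"
  let ?a = "normal_prob \<sigma> x {\<xi>..}"
  interpret N: prob_space ?N by (rule prob_space_normal_density) fact
  have pmf_space: "measure_pmf R \<in> space (subprob_algebra (count_space UNIV))" for R :: "'b pmf"
    by (simp add: measure_pmf_in_subprob_algebra)
  have [measurable]: "?f \<in> measurable ?N (subprob_algebra (count_space UNIV))"
    using pmf_space by measurable
  have ne: "space ?N \<noteq> {}" by simp
  show "sets (?N \<bind> ?f) = sets (measure_pmf (mix_pmf ?a P Q))"
    using ne by (subst sets_bind[where N = "count_space UNIV"]) auto
  fix X :: "'b set"
  let ?S = "{z. x + z \<in> {\<xi>..}}"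
  have [measurable]: "?S \<in> sets borel" by measurable
  have emeasure_S: "emeasure ?N ?S = ennreal ?a" "emeasure ?N (- ?S) = ennreal (1 - ?a)"
    using normal_prob_eq_prob_shift[of "{\<xi>..}" \<sigma> x] N.prob_compl[of ?S] assms
    by (simp_all add: N.emeasure_eq_measure Compl_eq_Diff_UNIV)
  have "emeasure (?N \<bind> ?f) X = (\<integral>\<^sup>+z. emeasure (?f z) X \<partial>?N)"
    using ne by (intro emeasure_bind[where N = "count_space UNIV"]) auto
  also have "\<dots> = (\<integral>\<^sup>+z. emeasure P X * indicator ?S z + emeasure Q X * indicator (- ?S) z \<partial>?N)"
    by (intro nn_integral_cong) (auto simp: indicator_def)
  also have "\<dots> = emeasure P X * emeasure ?N ?S + emeasure Q X * emeasure ?N (- ?S)"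
    by (subst nn_integral_add) (auto simp: nn_integral_cmult_indicator)
  also have "\<dots> = emeasure (mix_pmf ?a P Q) X"
    unfolding emeasure_S using assms
    by (subst emeasure_mix) (auto simp: normal_prob_nonneg normal_prob_le_1 mult.commute)
  finally show "emeasure (?N \<bind> ?f) X = emeasure (measure_pmf (mix_pmf ?a P Q)) X" .
qed

text \<open>Both half-lines have positive Lebesgue measure. Strictness keeps both branches possible
  on every database, which gives the inclusion of supports in
  \<open>pmf_renyi_le_mix\<close>.\<close>

lemma normal_prob_atLeast_bounds:
  assumes "0 < \<sigma>"
  shows "0 < normal_prob \<sigma> x {\<xi>..}" "normal_prob \<sigma> x {\<xi>..} < 1"
proof -
  have inf: "emeasure lborel {\<xi>..} \<noteq> 0" "emeasure lborel (- {\<xi>..}) \<noteq> 0"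
  proof -
    have "emeasure lborel {\<xi>..\<xi> + 1} \<le> emeasure lborel {\<xi>..}"
      by (rule emeasure_mono) auto
    moreover have "emeasure lborel {\<xi> - 2..\<xi> - 1} \<le> emeasure lborel (- {\<xi>..})"
      by (rule emeasure_mono) auto
    ultimately show "emeasure lborel {\<xi>..} \<noteq> 0" "emeasure lborel (- {\<xi>..}) \<noteq> 0"
      by auto
  qed
  show "0 < normal_prob \<sigma> x {\<xi>..}"
    using inf assms by (intro normal_prob_pos) auto
  have "0 < normal_prob \<sigma> x (- {\<xi>..})"
    using inf assms by (intro normal_prob_pos) auto
  then show "normal_prob \<sigma> x {\<xi>..} < 1"
    using normal_prob_Compl[of "{\<xi>..}" \<sigma> x] assms by simp
qed

text \<open>
  Data processing: the tangent inequality is integrated over each of the two events separately.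
\<close>
lemma renyi_term_threshold_le:
  fixes \<xi> :: real
  assumes "0 < \<sigma>" "1 < \<alpha>" "\<bar>x - y\<bar> \<le> s"
  defines "a \<equiv> normal_prob \<sigma> x {\<xi>..}" and "b \<equiv> normal_prob \<sigma> y {\<xi>..}"
  shows "renyi_term \<alpha> a b + renyi_term \<alpha> (1 - a) (1 - b) \<le> exp (\<alpha> * (\<alpha> - 1) * s\<^sup>2 / (2 * \<sigma>\<^sup>2))"
proof -
  define m where "m = \<alpha> * x + (1 - \<alpha>) * y"
  define E where "E = exp (\<alpha> * (\<alpha> - 1) * (x - y)\<^sup>2 / (2 * \<sigma>\<^sup>2))"
  have compl: "normal_prob \<sigma> z (- {\<xi>..}) = 1 - normal_prob \<sigma> z {\<xi>..}" for z
    using assms by (intro normal_prob_Compl) auto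
  have "b \<noteq> 0" "1 - b \<noteq> 0"
    using normal_prob_atLeast_bounds[of \<sigma> y \<xi>] assms by (auto simp: b_def)
  then have "renyi_term \<alpha> a b + renyi_term \<alpha> (1 - a) (1 - b)
      \<le> E * normal_prob \<sigma> m {\<xi>..} + E * normal_prob \<sigma> m (- {\<xi>..})"
    unfolding a_def b_def compl[symmetric] E_def m_def using assms(1,2)
    by (intro add_mono renyi_term_normal_prob_le) auto
  also have "\<dots> = E" by (simp add: compl algebra_simps del: Compl_atLeast)
  also have "\<dots> \<le> exp (\<alpha> * (\<alpha> - 1) * s\<^sup>2 / (2 * \<sigma>\<^sup>2))"
    unfolding E_def exp_le_cancel_iff using assms power_mono[OF assms(3), of 2]
    by (intro divide_right_mono mult_left_mono) auto
  finally show ?thesis .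
qed

text \<open>A bound on the moment rather than on the divergence, because moments multiply along the
  iterations. The inclusion of supports is absolute continuity.\<close>

definition pmf_renyi_le :: "real \<Rightarrow> real \<Rightarrow> 'b pmf \<Rightarrow> 'b pmf \<Rightarrow> bool" where
  "pmf_renyi_le \<alpha> C P Q \<longleftrightarrow> finite (set_pmf Q) \<and> set_pmf P \<subseteq> set_pmf Q \<and>
    (\<Sum>x\<in>set_pmf Q. renyi_term \<alpha> (pmf P x) (pmf Q x)) \<le> C"

lemma pmf_renyi_le_sum:
  assumes "pmf_renyi_le \<alpha> C P Q" "finite A" "set_pmf Q \<subseteq> A"
  shows "(\<Sum>x\<in>A. renyi_term \<alpha> (pmf P x) (pmf Q x)) \<le> C"
proof -
  have "(\<Sum>x\<in>A. renyi_term \<alpha> (pmf P x) (pmf Q x)) = (\<Sum>x\<in>set_pmf Q. renyi_term \<alpha> (pmf P x) (pmf Q x))"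
    using assms by (intro sum.mono_neutral_right) (auto simp: renyi_term_def set_pmf_iff)
  then show ?thesis using assms(1) by (simp add: pmf_renyi_le_def)
qed

text \<open>Adaptive composition for one iteration: subadditivity separates the branches,
  multiplicativity of \<open>renyi_term\<close> splits off the moment of the coin, and
  \<open>C\<close> bounds what is left of each branch.\<close>

lemma pmf_renyi_le_mix:
  assumes \<alpha>: "1 < \<alpha>" and ab: "0 < a" "a < 1" "0 < b" "b < 1"
    and 1: "pmf_renyi_le \<alpha> C P1 Q1" and 2: "pmf_renyi_le \<alpha> C P2 Q2"
    and E: "renyi_term \<alpha> a b + renyi_term \<alpha> (1 - a) (1 - b) \<le> E" and C: "0 \<le> C"
  shows "pmf_renyi_le \<alpha> (E * C) (mix_pmf a P1 P2) (mix_pmf b Q1 Q2)"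
proof -
  let ?A = "set_pmf Q1 \<union> set_pmf Q2"
  have fin: "finite ?A" and sub: "set_pmf P1 \<subseteq> set_pmf Q1" "set_pmf P2 \<subseteq> set_pmf Q2"
    using 1 2 by (auto simp: pmf_renyi_le_def)
  have "(\<Sum>x\<in>?A. renyi_term \<alpha> (pmf (mix_pmf a P1 P2) x) (pmf (mix_pmf b Q1 Q2) x))
      \<le> (\<Sum>x\<in>?A. renyi_term \<alpha> a b * renyi_term \<alpha> (pmf P1 x) (pmf Q1 x)
          + renyi_term \<alpha> (1 - a) (1 - b) * renyi_term \<alpha> (pmf P2 x) (pmf Q2 x))"
  proof (rule sum_mono)
    fix x
    have "renyi_term \<alpha> (a * pmf P1 x + (1 - a) * pmf P2 x) (b * pmf Q1 x + (1 - b) * pmf Q2 x)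
      \<le> renyi_term \<alpha> (a * pmf P1 x) (b * pmf Q1 x)
          + renyi_term \<alpha> ((1 - a) * pmf P2 x) ((1 - b) * pmf Q2 x)"
      using \<alpha> ab sub by (intro renyi_term_add_le) (auto simp: pmf_eq_0_set_pmf)
    then show "renyi_term \<alpha> (pmf (mix_pmf a P1 P2) x) (pmf (mix_pmf b Q1 Q2) x)
        \<le> renyi_term \<alpha> a b * renyi_term \<alpha> (pmf P1 x) (pmf Q1 x)
          + renyi_term \<alpha> (1 - a) (1 - b) * renyi_term \<alpha> (pmf P2 x) (pmf Q2 x)"
      using ab by (simp add: pmf_mix renyi_term_mult)
  qed
  also have "\<dots> = renyi_term \<alpha> a b * (\<Sum>x\<in>?A. renyi_term \<alpha> (pmf P1 x) (pmf Q1 x))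
      + renyi_term \<alpha> (1 - a) (1 - b) * (\<Sum>x\<in>?A. renyi_term \<alpha> (pmf P2 x) (pmf Q2 x))"
    by (simp add: sum.distrib sum_distrib_left)
  also have "\<dots> \<le> renyi_term \<alpha> a b * C + renyi_term \<alpha> (1 - a) (1 - b) * C"
    using ab fin by (intro add_mono mult_left_mono pmf_renyi_le_sum[OF 1] pmf_renyi_le_sum[OF 2])
      (auto intro: renyi_term_nonneg)
  also have "\<dots> = (renyi_term \<alpha> a b + renyi_term \<alpha> (1 - a) (1 - b)) * C"
    by (simp add: algebra_simps)
  also have "\<dots> \<le> E * C"
    using E C by (rule mult_right_mono)
  finally show ?thesis
    using fin sub ab by (auto simp: pmf_renyi_le_def set_pmf_mix)
qed

section \<open>One iteration and the length of the search\<close>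

lemma rank_bound_loop_step:
  assumes "1 \<le> lo" "hi \<le> n" "lo < hi" "0 < \<sigma>" and "t = (hi + lo) div 2"
    and "rank_bound_loop n \<sigma> \<xi> d lo (max (t - 1) 1) = measure_pmf P"
    and "rank_bound_loop n \<sigma> \<xi> d (min (t + 1) n) hi = measure_pmf Q"
  shows "rank_bound_loop n \<sigma> \<xi> d lo hi = measure_pmf (mix_pmf (normal_prob \<sigma> (d t) {\<xi>..}) P Q)"
  using normal_threshold_bind[of \<sigma> \<xi> "d t" P Q] assms(3,4)
  by (subst rank_bound_loop_eq[OF assms(1,2)]) (simp only: Let_def assms(5)[symmetric] assms(6,7) if_True)

lemma rank_bound_loop_halt:
  assumes "1 \<le> lo" "hi \<le> n" "hi \<le> lo"
  shows "rank_bound_loop n \<sigma> \<xi> d lo hi = measure_pmf (return_pmf hi)"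
  using assms by (simp add: rank_bound_loop_eq return_pmf.rep_eq)

text \<open>A bound \<open>hi + 1 < 2 ^ (j + 1) + lo\<close> says that fewer than
  \<open>2 ^ (j + 1)\<close> positions are left, written without truncated subtraction. Here
  \<open>j\<close> bounds the remaining iterations, and \<open>j = 0\<close> forces
  \<open>hi \<le> lo\<close>.\<close>

lemma binary_search_halves:
  fixes lo hi n j :: nat
  assumes "1 \<le> lo" "hi \<le> n" "lo < hi" "hi + 1 < 2 ^ (Suc j + 1) + lo" "t = (hi + lo) div 2"
  shows "max (t - 1) 1 \<le> n" "1 \<le> min (t + 1) n"
    "max (t - 1) 1 + 1 < 2 ^ (j + 1) + lo" "hi + 1 < 2 ^ (j + 1) + min (t + 1) n"
proof -
  \<comment> \<open>The inequality \<open>2 \<le> 2 ^ (j + 1)\<close> covers the clamped case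
    \<open>t = 1\<close>, where \<open>max (t - 1) 1\<close> leaves one position.\<close>
  have pow: "(2::nat) ^ (Suc j + 1) = 2 * 2 ^ (j + 1)" "(2::nat) \<le> 2 ^ (j + 1)" by simp_all
  have t: "2 * t \<le> hi + lo" "hi + lo \<le> 2 * t + 1" using assms(5) by linarith+
  show "max (t - 1) 1 \<le> n" "1 \<le> min (t + 1) n"
    "max (t - 1) 1 + 1 < 2 ^ (j + 1) + lo" "hi + 1 < 2 ^ (j + 1) + min (t + 1) n"
    using assms(1-4) pow t by linarith+
qed

text \<open>Induction on a bound \<open>j\<close> for the remaining iterations. In a given state
  both databases query the same position, so an iteration changes only the bias of the coin and
  costs one factor \<open>exp ?K\<close>. Positivity of \<open>\<sigma>\<close> is asked for only if
  \<open>j \<noteq> 0\<close>, because for a single predicate \<open>\<sigma>\<close> is 0.\<close>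

lemma rank_bound_loop_renyi:
  assumes "1 < \<alpha>" "\<And>t. 1 \<le> t \<Longrightarrow> t \<le> n \<Longrightarrow> \<bar>d t - d' t\<bar> \<le> s"
    and "j \<noteq> 0 \<Longrightarrow> 0 < \<sigma>" and "1 \<le> lo" "hi \<le> n" "hi + 1 < 2 ^ (j + 1) + lo"
  shows "\<exists>P Q. rank_bound_loop n \<sigma> \<xi> d lo hi = measure_pmf P \<and>
      rank_bound_loop n \<sigma> \<xi> d' lo hi = measure_pmf Q \<and>
      pmf_renyi_le \<alpha> (exp (j * (\<alpha> * (\<alpha> - 1) * s\<^sup>2 / (2 * \<sigma>\<^sup>2)))) P Q"
  using assms(3-)
proof (induction j arbitrary: lo hi)
  \<comment> \<open>A halted loop returns \<open>hi\<close> for both databases, which has moment 1.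
    Any \<open>j\<close> is allowed because the loop may halt early.\<close>
  have halt: "\<exists>P Q. rank_bound_loop n \<sigma> \<xi> d lo hi = measure_pmf P \<and>
      rank_bound_loop n \<sigma> \<xi> d' lo hi = measure_pmf Q \<and>
      pmf_renyi_le \<alpha> (exp (j * (\<alpha> * (\<alpha> - 1) * s\<^sup>2 / (2 * \<sigma>\<^sup>2)))) P Q"
    if "1 \<le> lo" "hi \<le> n" "hi \<le> lo" for lo hi j :: nat
  proof (intro exI conjI)
    have "0 \<le> j * (\<alpha> * (\<alpha> - 1) * s\<^sup>2 / (2 * \<sigma>\<^sup>2))"
      using assms(1) by simp
    then show "pmf_renyi_le \<alpha> (exp (j * (\<alpha> * (\<alpha> - 1) * s\<^sup>2 / (2 * \<sigma>\<^sup>2)))) (return_pmf hi) (return_pmf hi)"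
      by (simp add: pmf_renyi_le_def renyi_term_def)
  qed (use that rank_bound_loop_halt in auto)
  {
    case 0
    then show ?case by (intro halt) auto
  next
    case (Suc j)
    then have \<sigma>: "0 < \<sigma>" by simp
    show ?case
    proof (cases "lo < hi")
      case False
      then show ?thesis using Suc.prems by (intro halt) auto
    next
      case True
      define t where "t = (hi + lo) div 2"
      have t: "1 \<le> t" "t \<le> n"
        using Suc.prems True by (auto simp: t_def)
      note halves = binary_search_halves[OF Suc.prems(2,3) True Suc.prems(4) t_def]
      let ?K = "\<alpha> * (\<alpha> - 1) * s\<^sup>2 / (2 * \<sigma>\<^sup>2)"
      obtain P1 Q1 where 1: "rank_bound_loop n \<sigma> \<xi> d lo (max (t - 1) 1) = measure_pmf P1"
        "rank_bound_loop n \<sigma> \<xi> d' lo (max (t - 1) 1) = measure_pmf Q1"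
        "pmf_renyi_le \<alpha> (exp (j * ?K)) P1 Q1"
        using Suc.IH[OF \<sigma> Suc.prems(2) halves(1,3)] by blast
      obtain P2 Q2 where 2: "rank_bound_loop n \<sigma> \<xi> d (min (t + 1) n) hi = measure_pmf P2"
        "rank_bound_loop n \<sigma> \<xi> d' (min (t + 1) n) hi = measure_pmf Q2"
        "pmf_renyi_le \<alpha> (exp (j * ?K)) P2 Q2"
        using Suc.IH[OF \<sigma> halves(2) Suc.prems(3) halves(4)] by blast
      have "pmf_renyi_le \<alpha> (exp ?K * exp (j * ?K))
          (mix_pmf (normal_prob \<sigma> (d t) {\<xi>..}) P1 P2) (mix_pmf (normal_prob \<sigma> (d' t) {\<xi>..}) Q1 Q2)"
        using assms(1,2) t \<sigma> 1(3) 2(3) normal_prob_atLeast_bounds[OF \<sigma>]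
        by (intro pmf_renyi_le_mix renyi_term_threshold_le) auto
      then have "pmf_renyi_le \<alpha> (exp (Suc j * ?K))
          (mix_pmf (normal_prob \<sigma> (d t) {\<xi>..}) P1 P2) (mix_pmf (normal_prob \<sigma> (d' t) {\<xi>..}) Q1 Q2)"
        by (simp only: of_nat_Suc distrib_right exp_add mult_1)
      then show ?thesis
        using rank_bound_loop_step[OF Suc.prems(2,3) True \<sigma> t_def 1(1) 2(1)]
          rank_bound_loop_step[OF Suc.prems(2,3) True \<sigma> t_def 1(2) 2(2)] by blast
    qed
  }
qed

text \<open>Union bound for one iteration, with \<open>e\<close> the loss per iteration. Call a
  branch good if it succeeds with probability at least \<open>1 - j * e\<close>: some branch is
  good, and a branch that is not good is taken with probability at most \<open>e\<close>.\<close>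

lemma mix_ge:
  fixes a x y j e :: real
  assumes "0 \<le> a" "a \<le> 1" "0 \<le> e" "0 \<le> j" "0 \<le> x" "0 \<le> y"
    and "a \<le> e \<or> 1 - j * e \<le> x" "1 - a \<le> e \<or> 1 - j * e \<le> y" "1 - j * e \<le> x \<or> 1 - j * e \<le> y"
  shows "1 - (j + 1) * e \<le> a * x + (1 - a) * y"
proof -
  \<comment> \<open>Here \<open>w\<close> belongs to a good branch; the other case below exchanges
    the branches and replaces \<open>a\<close> by \<open>1 - a\<close>.\<close>
  have *: "1 - (j + 1) * e \<le> c * z + (1 - c) * w"
    if "0 \<le> c" "c \<le> 1" "0 \<le> z" "0 \<le> w" "1 - j * e \<le> w" "c \<le> e \<or> 1 - j * e \<le> z" for c z w
    using that(6)
  proof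
    assume "c \<le> e"
    have "(1 - c) * (1 - j * e) \<le> (1 - c) * w" using that by (intro mult_left_mono) auto
    moreover have "0 \<le> c * z" "0 \<le> c * (j * e)" using that assms by auto
    ultimately show ?thesis using \<open>c \<le> e\<close> by (simp add: algebra_simps)
  next
    assume "1 - j * e \<le> z"
    then have "c * (1 - j * e) + (1 - c) * (1 - j * e) \<le> c * z + (1 - c) * w"
      using that by (intro add_mono mult_left_mono) auto
    then show ?thesis using assms by (simp add: algebra_simps)
  qed
  from assms(9) show ?thesis
  proof
    assume "1 - j * e \<le> x"
    then show ?thesis using *[of "1 - a" y x] assms by (simp add: algebra_simps)
  next
    assume "1 - j * e \<le> y"
    then show ?thesis using *[of a x y] assms by simp
  qed
qed

text \<open>
  Whatever the true query value is, at least one branch preserves the loop invariant \<open>G\<close>; hence only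
  the other branch can lose it, which costs probability at most \<open>e\<close> per iteration.
\<close>
lemma rank_bound_loop_invariant:
  assumes "0 \<le> e" and "\<And>lo hi. G lo hi \<Longrightarrow> 1 \<le> lo \<Longrightarrow> hi \<le> n \<Longrightarrow> hi \<le> lo \<Longrightarrow> hi \<in> S"
    and "\<And>lo hi t. 0 < \<sigma> \<Longrightarrow> G lo hi \<Longrightarrow> 1 \<le> lo \<Longrightarrow> hi \<le> n \<Longrightarrow> lo \<le> t \<Longrightarrow> t < hi \<Longrightarrow>
      (normal_prob \<sigma> (d t) {\<xi>..} \<le> e \<or> G lo (max (t - 1) 1)) \<and>
      (1 - normal_prob \<sigma> (d t) {\<xi>..} \<le> e \<or> G (min (t + 1) n) hi) \<and>
      (G lo (max (t - 1) 1) \<or> G (min (t + 1) n) hi)"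
    and "j \<noteq> 0 \<Longrightarrow> 0 < \<sigma>" and "1 \<le> lo" "hi \<le> n" "hi + 1 < 2 ^ (j + 1) + lo"
  shows "\<exists>P. rank_bound_loop n \<sigma> \<xi> d lo hi = measure_pmf P \<and> (G lo hi \<longrightarrow> 1 - real j * e \<le> measure_pmf.prob P S)"
  using assms(4-)
proof (induction j arbitrary: lo hi)
  have halt: "\<exists>P. rank_bound_loop n \<sigma> \<xi> d lo hi = measure_pmf P \<and> (G lo hi \<longrightarrow> 1 - real j * e \<le> measure_pmf.prob P S)"
    if "1 \<le> lo" "hi \<le> n" "hi \<le> lo" for lo hi j :: nat
  proof (intro exI conjI impI)
    assume "G lo hi"
    then show "1 - real j * e \<le> measure_pmf.prob (return_pmf hi) S"
      using that assms(1,2) by simp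
  qed (use that rank_bound_loop_halt in auto)
  {
    case 0
    then show ?case by (intro halt) auto
  next
    case (Suc j)
    then have \<sigma>: "0 < \<sigma>" by simp
    show ?case
    proof (cases "lo < hi")
      case False
      then show ?thesis using Suc.prems by (intro halt) auto
    next
      case True
      define t where "t = (hi + lo) div 2"
      have t: "lo \<le> t" "t < hi"
        using Suc.prems True by (auto simp: t_def)
      note halves = binary_search_halves[OF Suc.prems(2,3) True Suc.prems(4) t_def]
      obtain P where P: "rank_bound_loop n \<sigma> \<xi> d lo (max (t - 1) 1) = measure_pmf P"
        "G lo (max (t - 1) 1) \<longrightarrow> 1 - real j * e \<le> measure_pmf.prob P S"
        using Suc.IH[OF \<sigma> Suc.prems(2) halves(1,3)] by blast
      obtain Q where Q: "rank_bound_loop n \<sigma> \<xi> d (min (t + 1) n) hi = measure_pmf Q"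
        "G (min (t + 1) n) hi \<longrightarrow> 1 - real j * e \<le> measure_pmf.prob Q S"
        using Suc.IH[OF \<sigma> halves(2) Suc.prems(3) halves(4)] by blast
      let ?a = "normal_prob \<sigma> (d t) {\<xi>..}"
      have a: "0 \<le> ?a" "?a \<le> 1"
        using normal_prob_atLeast_bounds[OF \<sigma>, of "d t" \<xi>] by auto
      have "1 - (real j + 1) * e \<le> ?a * measure_pmf.prob P S + (1 - ?a) * measure_pmf.prob Q S" if "G lo hi"
        using a assms(1) P(2) Q(2) assms(3)[OF \<sigma> that Suc.prems(2,3) t] by (intro mix_ge) auto
      then have "G lo hi \<longrightarrow> 1 - real (Suc j) * e \<le> measure_pmf.prob (mix_pmf ?a P Q) S"
        by (simp add: measure_mix[OF a] add.commute)
      then show ?thesis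
        using rank_bound_loop_step[OF Suc.prems(2,3) True \<sigma> t_def P(1) Q(1)] by blast
    qed
  }
qed

section \<open>Renyi moments of product measures\<close>

text \<open>An explicit density instead of \<open>RN_deriv\<close>, which is determined only almost
  everywhere: explicit densities can be multiplied to give densities of product measures.\<close>

definition renyi_moment_le :: "real \<Rightarrow> real \<Rightarrow> 'b measure \<Rightarrow> 'b measure \<Rightarrow> bool" where
  "renyi_moment_le \<alpha> C P Q \<longleftrightarrow> (\<exists>f :: 'b \<Rightarrow> real. f \<in> borel_measurable Q \<and> (\<forall>x. 0 \<le> f x) \<and>
    P = density Q f \<and> (\<integral>\<^sup>+x. ennreal (f x powr \<alpha>) \<partial>Q) \<le> ennreal C)"

lemma renyi_moment_le_pmf:
  assumes "pmf_renyi_le \<alpha> C P Q"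
  shows "renyi_moment_le \<alpha> C (measure_pmf P) (measure_pmf Q)"
  unfolding renyi_moment_le_def
proof (intro exI[of _ "\<lambda>x. pmf P x / pmf Q x"] conjI allI)
  have fin: "finite (set_pmf Q)" and sub: "set_pmf P \<subseteq> set_pmf Q"
    using assms by (auto simp: pmf_renyi_le_def)
  have "density Q (\<lambda>x. pmf P x / pmf Q x)
      = density (count_space UNIV) (\<lambda>x. ennreal (pmf Q x) * ennreal (pmf P x / pmf Q x))"
    unfolding measure_pmf_eq_density[of Q] by (subst density_density_eq) auto
  also have "(\<lambda>x. ennreal (pmf Q x) * ennreal (pmf P x / pmf Q x)) = (\<lambda>x. ennreal (pmf P x))"
  proof
    fix x
    \<comment> \<open>Division by zero gives density 0 off the support of \<open>Q\<close>; by the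
      inclusion of supports \<open>P\<close> has no mass there.\<close>
    have "pmf Q x = 0 \<Longrightarrow> pmf P x = 0"
      using sub by (auto simp: pmf_eq_0_set_pmf)
    then show "ennreal (pmf Q x) * ennreal (pmf P x / pmf Q x) = ennreal (pmf P x)"
      by (cases "pmf Q x = 0") (auto simp: ennreal_mult[symmetric])
  qed
  finally show "measure_pmf P = density Q (\<lambda>x. pmf P x / pmf Q x)"
    by (simp add: measure_pmf_eq_density)
  have "(\<integral>\<^sup>+x. ennreal ((pmf P x / pmf Q x) powr \<alpha>) \<partial>Q)
      = (\<Sum>x\<in>set_pmf Q. ennreal ((pmf P x / pmf Q x) powr \<alpha>) * ennreal (pmf Q x))"
    using fin by (intro nn_integral_measure_pmf_finite) auto
  also have "\<dots> = (\<Sum>x\<in>set_pmf Q. ennreal (renyi_term \<alpha> (pmf P x) (pmf Q x)))"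
    by (intro sum.cong refl) (simp add: renyi_term_def ennreal_mult[symmetric] mult.commute)
  also have "\<dots> = ennreal (\<Sum>x\<in>set_pmf Q. renyi_term \<alpha> (pmf P x) (pmf Q x))"
    by (intro sum_ennreal) (simp add: renyi_term_nonneg)
  also have "\<dots> \<le> ennreal C"
    using assms by (intro ennreal_leI) (simp add: pmf_renyi_le_def)
  finally show "(\<integral>\<^sup>+x. ennreal ((pmf P x / pmf Q x) powr \<alpha>) \<partial>Q) \<le> ennreal C" .
qed auto

text \<open>The product of the densities is a density of the product, and Tonelli factors its
  moment.\<close>

lemma renyi_moment_le_pair:
  assumes 1: "renyi_moment_le \<alpha> C1 P1 Q1" and 2: "renyi_moment_le \<alpha> C2 P2 Q2"
    and prob: "prob_space P2" "prob_space Q1" "prob_space Q2" and C: "0 \<le> C1" "0 \<le> C2"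
  shows "renyi_moment_le \<alpha> (C1 * C2) (P1 \<Otimes>\<^sub>M P2) (Q1 \<Otimes>\<^sub>M Q2)"
proof -
  interpret Q1: prob_space Q1 by fact
  interpret Q2: prob_space Q2 by fact
  interpret P2: prob_space P2 by fact
  obtain f where f [measurable]: "f \<in> borel_measurable Q1" and f0: "\<And>x. 0 \<le> f x"
    and P1: "P1 = density Q1 f" and fC: "(\<integral>\<^sup>+x. ennreal (f x powr \<alpha>) \<partial>Q1) \<le> ennreal C1"
    using 1 by (auto simp: renyi_moment_le_def)
  obtain g where g [measurable]: "g \<in> borel_measurable Q2" and g0: "\<And>x. 0 \<le> g x"
    and P2: "P2 = density Q2 g" and gC: "(\<integral>\<^sup>+x. ennreal (g x powr \<alpha>) \<partial>Q2) \<le> ennreal C2"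
    using 2 by (auto simp: renyi_moment_le_def)
  have "P1 \<Otimes>\<^sub>M P2 = density (Q1 \<Otimes>\<^sub>M Q2) (\<lambda>(x, y). ennreal (f x) * ennreal (g y))"
    unfolding P1 P2 using P2.sigma_finite_measure_axioms Q2.sigma_finite_measure_axioms P2
    by (intro pair_measure_density) auto
  also have "(\<lambda>(x, y). ennreal (f x) * ennreal (g y)) = (\<lambda>z. ennreal (f (fst z) * g (snd z)))"
    using f0 g0 by (auto simp: ennreal_mult)
  finally have eq: "P1 \<Otimes>\<^sub>M P2 = density (Q1 \<Otimes>\<^sub>M Q2) (\<lambda>z. ennreal (f (fst z) * g (snd z)))" .
  have "(\<integral>\<^sup>+z. ennreal ((f (fst z) * g (snd z)) powr \<alpha>) \<partial>(Q1 \<Otimes>\<^sub>M Q2))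
      = (\<integral>\<^sup>+z. ennreal (f (fst z) powr \<alpha>) * ennreal (g (snd z) powr \<alpha>) \<partial>(Q1 \<Otimes>\<^sub>M Q2))"
    using f0 g0 by (simp add: powr_mult ennreal_mult)
  also have "\<dots> = (\<integral>\<^sup>+x. \<integral>\<^sup>+y. ennreal (f x powr \<alpha>) * ennreal (g y powr \<alpha>) \<partial>Q2 \<partial>Q1)"
    by (subst Q2.nn_integral_fst[symmetric]) auto
  also have "\<dots> = (\<integral>\<^sup>+x. ennreal (f x powr \<alpha>) \<partial>Q1) * (\<integral>\<^sup>+y. ennreal (g y powr \<alpha>) \<partial>Q2)"
    by (simp add: nn_integral_cmult nn_integral_multc)
  also have "\<dots> \<le> ennreal (C1 * C2)"
    using fC gC C by (auto simp: ennreal_mult intro: mult_mono)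
  finally show ?thesis
    unfolding renyi_moment_le_def using eq f0 g0
    by (intro exI[of _ "\<lambda>z. f (fst z) * g (snd z)"]) auto
qed

text \<open>A product measure is determined by its values on boxes, and on these both the density
  and the indicator factor over the coordinates.\<close>

lemma renyi_moment_le_PiM:
  assumes fin: "finite I" and prob: "\<And>i. prob_space (P i)" "\<And>i. prob_space (Q i)"
    and le: "\<And>i. i \<in> I \<Longrightarrow> renyi_moment_le \<alpha> (C i) (P i) (Q i)" and C: "\<And>i. i \<in> I \<Longrightarrow> 0 \<le> C i"
  shows "renyi_moment_le \<alpha> (\<Prod>i\<in>I. C i) (PiM I P) (PiM I Q)"
proof -
  interpret P: product_prob_space P using prob by (intro product_prob_spaceI)
  interpret Q: product_prob_space Q using prob by (intro product_prob_spaceI)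
  have "\<forall>i\<in>I. \<exists>f :: 'b \<Rightarrow> real. f \<in> borel_measurable (Q i) \<and> (\<forall>x. 0 \<le> f x) \<and>
    P i = density (Q i) f \<and> (\<integral>\<^sup>+x. ennreal (f x powr \<alpha>) \<partial>Q i) \<le> ennreal (C i)"
    using le by (simp add: renyi_moment_le_def)
  then obtain f :: "'a \<Rightarrow> 'b \<Rightarrow> real" where f [measurable]: "\<And>i. i \<in> I \<Longrightarrow> f i \<in> borel_measurable (Q i)"
    and f0: "\<And>i x. i \<in> I \<Longrightarrow> 0 \<le> f i x"
    and P: "\<And>i. i \<in> I \<Longrightarrow> P i = density (Q i) (f i)"
    and fC: "\<And>i. i \<in> I \<Longrightarrow> (\<integral>\<^sup>+x. ennreal (f i x powr \<alpha>) \<partial>Q i) \<le> ennreal (C i)"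
    unfolding bchoice_iff by blast
  define F where "F = (\<lambda>x. \<Prod>i\<in>I. \<bar>f i (x i)\<bar>)"
  have F [measurable]: "F \<in> borel_measurable (PiM I Q)"
    unfolding F_def by measurable
  have "density (PiM I Q) F = PiM I P"
  proof (rule P.PiM_eqI)
    show "sets (density (PiM I Q) F) = sets (PiM I P)"
      using P by (auto intro!: sets_PiM_cong)
    fix A assume "\<And>i. i \<in> I \<Longrightarrow> A i \<in> sets (P i)"
    then have A [measurable]: "\<And>i. i \<in> I \<Longrightarrow> A i \<in> sets (Q i)"
      using P by simp
    then have PA: "Pi\<^sub>E I A \<in> sets (PiM I Q)"
      using fin by (intro sets_PiM_I_finite) auto
    have "emeasure (density (PiM I Q) F) (Pi\<^sub>E I A)
        = (\<integral>\<^sup>+x. ennreal (F x) * indicator (Pi\<^sub>E I A) x \<partial>PiM I Q)"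
      using PA by (subst emeasure_density) auto
    also have "\<dots> = (\<integral>\<^sup>+x. (\<Prod>i\<in>I. ennreal (f i (x i)) * indicator (A i) (x i)) \<partial>PiM I Q)"
    proof (rule nn_integral_cong)
      fix x assume "x \<in> space (PiM I Q)"
      then have "indicator (Pi\<^sub>E I A) x = (\<Prod>i\<in>I. indicator (A i) (x i) :: ennreal)"
        using fin by (auto simp: indicator_def space_PiM PiE_def Pi_iff prod_zero_iff split: if_splits)
      then show "ennreal (F x) * indicator (Pi\<^sub>E I A) x
          = (\<Prod>i\<in>I. ennreal (f i (x i)) * indicator (A i) (x i))"
        using f0 by (simp add: F_def prod.distrib prod_ennreal)
    qed
    also have "\<dots> = (\<Prod>i\<in>I. \<integral>\<^sup>+x. ennreal (f i x) * indicator (A i) x \<partial>Q i)"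
      using fin by (intro Q.product_nn_integral_prod) auto
    also have "\<dots> = (\<Prod>i\<in>I. emeasure (P i) (A i))"
      using P by (intro prod.cong refl) (simp add: emeasure_density)
    finally show "emeasure (density (PiM I Q) F) (Pi\<^sub>E I A) = (\<Prod>i\<in>I. emeasure (P i) (A i))" .
  qed (rule fin)
  moreover have "(\<integral>\<^sup>+x. ennreal (F x powr \<alpha>) \<partial>PiM I Q) \<le> ennreal (\<Prod>i\<in>I. C i)"
  proof -
    have "(\<integral>\<^sup>+x. ennreal (F x powr \<alpha>) \<partial>PiM I Q) = (\<integral>\<^sup>+x. (\<Prod>i\<in>I. ennreal (f i (x i) powr \<alpha>)) \<partial>PiM I Q)"
      using f0 by (simp add: F_def prod_powr_distrib prod_ennreal)
    also have "\<dots> = (\<Prod>i\<in>I. \<integral>\<^sup>+x. ennreal (f i x powr \<alpha>) \<partial>Q i)"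
      using fin by (intro Q.product_nn_integral_prod) auto
    also have "\<dots> \<le> (\<Prod>i\<in>I. ennreal (C i))"
      using fC by (intro prod_mono_ennreal) auto
    also have "\<dots> = ennreal (\<Prod>i\<in>I. C i)"
      using C by (intro prod_ennreal) auto
    finally show ?thesis .
  qed
  ultimately show ?thesis
    unfolding renyi_moment_le_def
    by (intro exI[of _ F]) (auto simp: F_def intro!: prod_nonneg F[unfolded F_def])
qed

text \<open>The density \<open>f\<close> agrees with \<open>RN_deriv\<close> almost everywhere,
  which suffices under the integral; taking the logarithm turns the moment bound into
  \<open>r\<close>.\<close>

lemma renyi_divergence_le:
  assumes "renyi_moment_le \<alpha> (exp ((\<alpha> - 1) * r)) P Q" "prob_space P" "prob_space Q" "1 < \<alpha>" "0 \<le> r"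
  shows "renyi_divergence \<alpha> P Q \<le> ereal r"
proof -
  interpret Q: prob_space Q by fact
  obtain f where f [measurable]: "f \<in> borel_measurable Q" and f0: "\<And>x. 0 \<le> f x"
    and P: "P = density Q f" and fC: "(\<integral>\<^sup>+x. ennreal (f x powr \<alpha>) \<partial>Q) \<le> ennreal (exp ((\<alpha> - 1) * r))"
    using assms(1) by (auto simp: renyi_moment_le_def)
  have ac: "absolutely_continuous Q P"
    unfolding P by (rule absolutely_continuousI_density) simp
  define I where "I = (\<integral>\<^sup>+x. ennreal (enn2real (RN_deriv Q P x) powr \<alpha>) \<partial>Q)"
  have "AE x in Q. ennreal (f x) = RN_deriv Q P x"
    by (rule Q.RN_deriv_unique) (simp_all add: P)
  then have "I = (\<integral>\<^sup>+x. ennreal (f x powr \<alpha>) \<partial>Q)"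
    unfolding I_def by (intro nn_integral_cong_AE, eventually_elim) (metis enn2real_ennreal f0)
  then have I: "I \<le> ennreal (exp ((\<alpha> - 1) * r))" using fC by simp
  then have fin: "I \<noteq> \<infinity>" by (auto simp: top_unique)
  have "enn2real I \<le> exp ((\<alpha> - 1) * r)"
    using I by (intro enn2real_leI) auto
  then have "ln (enn2real I) \<le> (\<alpha> - 1) * r"
  proof (cases "enn2real I = 0")
    case True
    \<comment> \<open>Since \<open>ln 0 = 0\<close> by convention, the claim is
      \<open>0 \<le> (\<alpha> - 1) * r\<close>.\<close>
    then show ?thesis using assms by simp
  next
    case False
    then have "0 < enn2real I" by (simp add: less_le)
    then show ?thesis using \<open>enn2real I \<le> _\<close> ln_le_cancel_iff[of "enn2real I" "exp ((\<alpha> - 1) * r)"] by simp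
  qed
  then have "1 / (\<alpha> - 1) * ln (enn2real I) \<le> r"
    using assms by (simp add: field_simps)
  then show ?thesis
    using ac fin by (simp add: renyi_divergence_def I_def[symmetric] Let_def)
qed

section \<open>Ranks\<close>

lemma ranking_props:
  assumes "finite Preds" "linear_order_on Preds tie"
  shows "distinct (ranking Preds tie infl D)" "set (ranking Preds tie infl D) = Preds"
    "sorted_wrt (ranked_before tie infl D) (ranking Preds tie infl D)"
    "length (ranking Preds tie infl D) = card Preds"
proof -
  show *: "distinct (ranking Preds tie infl D)" "set (ranking Preds tie infl D) = Preds"
    "sorted_wrt (ranked_before tie infl D) (ranking Preds tie infl D)"
    using theI'[OF ranking_ex1[OF assms, of infl D]] unfolding ranking_def by auto
  then show "length (ranking Preds tie infl D) = card Preds"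
    using distinct_card by metis
qed

lemma ranking_antimono:
  assumes "finite Preds" "linear_order_on Preds tie" "i \<le> j" "j < card Preds"
  shows "infl (ranking Preds tie infl D ! j) D \<le> infl (ranking Preds tie infl D ! i) D"
proof (cases "i = j")
  case False
  then have "ranked_before tie infl D (ranking Preds tie infl D ! i) (ranking Preds tie infl D ! j)"
    using assms ranking_props[OF assms(1,2), of infl D]
    by (intro sorted_wrt_nth_less[OF ranking_props(3)[OF assms(1,2)]]) auto
  then show ?thesis by (auto simp: ranked_before_def)
qed simp

text \<open>
  Order statistics have the sensitivity of the individual values: by pigeonhole, one of the first
  \<open>i + 1\<close> predicates for \<open>D'\<close> is not among the first \<open>i\<close> ones for \<open>D\<close>.
\<close>
lemma ranking_nth_le:
  assumes "finite Preds" "linear_order_on Preds tie" "i < card Preds"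
    and s: "\<And>q. q \<in> Preds \<Longrightarrow> infl q D' \<le> infl q D + s"
  shows "infl (ranking Preds tie infl D' ! i) D' \<le> infl (ranking Preds tie infl D ! i) D + s"
proof -
  let ?ps = "ranking Preds tie infl D" and ?qs = "ranking Preds tie infl D'"
  note ps = ranking_props[OF assms(1,2), of infl D] and qs = ranking_props[OF assms(1,2), of infl D']
  have "card (set (take (Suc i) ?qs)) = Suc i"
    using qs assms(3) by (simp add: distinct_card)
  moreover have "card (set (take i ?ps)) \<le> i"
    using card_length[of "take i ?ps"] by simp
  ultimately have "\<not> set (take (Suc i) ?qs) \<subseteq> set (take i ?ps)"
    using card_mono[of "set (take i ?ps)" "set (take (Suc i) ?qs)"] by auto
  then obtain r where r: "r \<in> set (take (Suc i) ?qs)" "r \<notin> set (take i ?ps)" by blast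
  then obtain a where a: "a \<le> i" "r = ?qs ! a"
    by (auto simp: in_set_conv_nth less_Suc_eq_le)
  have "r \<in> Preds" using r qs(2) in_set_takeD by fastforce
  then obtain b where b: "b < card Preds" "r = ?ps ! b"
    using ps(2,4) by (metis in_set_conv_nth)
  have "i \<le> b"
  proof (rule ccontr)
    assume "\<not> i \<le> b"
    then have "r \<in> set (take i ?ps)"
      using b ps(4) by (auto simp: in_set_conv_nth intro!: exI[of _ b])
    then show False using r by simp
  qed
  \<comment> \<open>\<open>a \<le> i\<close> is used in the ranking for \<open>D'\<close> and
    \<open>i \<le> b\<close> in the one for \<open>D\<close>; only the single predicate
    \<open>r\<close> is compared across the databases.\<close>
  have "infl (?qs ! i) D' \<le> infl r D'"
    using ranking_antimono[OF assms(1,2) a(1) assms(3)] a(2) by simp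
  also have "\<dots> \<le> infl r D + s" using s \<open>r \<in> Preds\<close> by simp
  also have "\<dots> \<le> infl (?ps ! i) D + s"
    using ranking_antimono[OF assms(1,2) \<open>i \<le> b\<close> b(1)] b(2) by simp
  finally show ?thesis .
qed

lemma has_sensitivityD:
  assumes "has_sensitivity Preds infl \<Delta>" "p \<in> Preds" "neighboring D D'"
  shows "\<bar>infl p D - infl p D'\<bar> \<le> \<Delta>"
  using assms unfolding has_sensitivity_def by blast

text \<open>The value of \<open>p\<close> and the value at rank \<open>t\<close> each move by at
  most \<open>\<Delta>\<close>. The predicate at rank \<open>t\<close> may itself change, so the
  second bound is the one for order statistics.\<close>

lemma query_sensitivity:
  assumes "finite Preds" "linear_order_on Preds tie" "has_sensitivity Preds infl \<Delta>"
    and "neighboring D D'" "p \<in> Preds" "1 \<le> t" "t \<le> card Preds"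
  shows "\<bar>(infl p D - infl (infl_rank_inv Preds tie infl D t) D)
    - (infl p D' - infl (infl_rank_inv Preds tie infl D' t) D')\<bar> \<le> 2 * \<Delta>"
proof -
  note sens = has_sensitivityD[OF assms(3) _ assms(4)]
  have le: "infl q D' \<le> infl q D + \<Delta>" "infl q D \<le> infl q D' + \<Delta>" if "q \<in> Preds" for q
    using sens[OF that] by linarith+
  have t: "t - 1 < card Preds" using assms(6,7) by linarith
  have "infl (infl_rank_inv Preds tie infl D' t) D' \<le> infl (infl_rank_inv Preds tie infl D t) D + \<Delta>"
    unfolding infl_rank_inv_def by (rule ranking_nth_le[OF assms(1,2) t le(1)])
  moreover have "infl (infl_rank_inv Preds tie infl D t) D \<le> infl (infl_rank_inv Preds tie infl D' t) D' + \<Delta>"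
    unfolding infl_rank_inv_def by (rule ranking_nth_le[OF assms(1,2) t le(2)])
  ultimately show ?thesis using sens[OF assms(5)] by linarith
qed

lemma infl_rank_props:
  assumes "finite Preds" "linear_order_on Preds tie" "p \<in> Preds"
  shows "infl_rank Preds tie infl D p \<in> {1..card Preds}"
    "infl_rank_inv Preds tie infl D (infl_rank Preds tie infl D p) = p"
proof -
  note ps = ranking_props[OF assms(1,2), of infl D]
  obtain i where i: "i < card Preds" "ranking Preds tie infl D ! i = p"
    using assms(3) ps(2,4) by (metis in_set_conv_nth)
  have "\<exists>!t. t \<in> {1..card Preds} \<and> infl_rank_inv Preds tie infl D t = p"
  \<comment> \<open>List indices start at 0 and ranks at 1; \<open>1 \<le> t\<close> excludes
    \<open>t = 0\<close>, for which \<open>t - 1\<close> is 0 as well.\<close>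
  proof (rule ex1I[of _ "Suc i"])
    fix t assume "t \<in> {1..card Preds} \<and> infl_rank_inv Preds tie infl D t = p"
    then have "t - 1 = i"
      using i ps(1,4) nth_eq_iff_index_eq[of "ranking Preds tie infl D" "t - 1" i]
      by (auto simp: infl_rank_inv_def)
    then show "t = Suc i" using \<open>t \<in> _ \<and> _\<close> by auto
  qed (use i in \<open>auto simp: infl_rank_inv_def\<close>)
  from theI'[OF this] show "infl_rank Preds tie infl D p \<in> {1..card Preds}"
    "infl_rank_inv Preds tie infl D (infl_rank Preds tie infl D p) = p"
    unfolding infl_rank_def by auto
qed

lemma infl_rank_inv_mono:
  assumes "finite Preds" "linear_order_on Preds tie" "1 \<le> t" "t \<le> t'" "t' \<le> card Preds"
  shows "infl (infl_rank_inv Preds tie infl D t') D \<le> infl (infl_rank_inv Preds tie infl D t) D"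
  unfolding infl_rank_inv_def using assms by (intro ranking_antimono) auto

section \<open>Rank bounds\<close>

definition rank_bound_depth :: "'p set \<Rightarrow> nat" where
  "rank_bound_depth Preds = nat \<lceil>log 2 (card Preds)\<rceil>"

definition rank_bound_sd :: "'p set \<Rightarrow> real \<Rightarrow> real \<Rightarrow> real" where
  "rank_bound_sd Preds \<Delta> \<rho> = 2 * \<Delta> / sqrt (2 * (\<rho> / rank_bound_depth Preds))"

definition rank_bound_threshold :: "'p set \<Rightarrow> real \<Rightarrow> real \<Rightarrow> real \<Rightarrow> real" where
  "rank_bound_threshold Preds \<Delta> \<rho> \<beta> =
    rank_bound_sd Preds \<Delta> \<rho> * sqrt (2 * ln (rank_bound_depth Preds / (1 - \<beta>)))"

text \<open>That \<open>card Preds\<close> is at most 2 to the depth, in the form that the loop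
  lemmas ask for at \<open>lo = 1\<close> and \<open>hi = card Preds\<close>.\<close>

lemma rank_bound_depth_bound:
  assumes "finite Preds" "Preds \<noteq> {}"
  shows "card Preds + 1 < 2 ^ (rank_bound_depth Preds + 1) + 1"
    "real (rank_bound_depth Preds) = real_of_int \<lceil>log 2 (card Preds)\<rceil>"
proof -
  have n: "1 \<le> card Preds" using assms by (simp add: Suc_le_eq card_gt_0_iff)
  then have "0 \<le> log 2 (card Preds)" by simp
  then show eq: "real (rank_bound_depth Preds) = real_of_int \<lceil>log 2 (card Preds)\<rceil>"
    by (simp add: rank_bound_depth_def)
  have "log 2 (card Preds) \<le> rank_bound_depth Preds"
    unfolding eq by simp
  then have "real (card Preds) \<le> 2 powr rank_bound_depth Preds"
    using n by (subst (asm) log_le_iff) auto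
  then have "real (card Preds) \<le> real (2 ^ rank_bound_depth Preds)"
    by (simp add: powr_realpow)
  then have "card Preds \<le> 2 ^ rank_bound_depth Preds"
    by (simp only: of_nat_le_iff)
  then show "card Preds + 1 < 2 ^ (rank_bound_depth Preds + 1) + 1"
    using n by simp
qed

lemma rank_bound_eq:
  assumes "finite Preds" "Preds \<noteq> {}"
  shows "rank_bound Preds tie infl \<Delta> D p \<rho> \<beta> dir =
    rank_bound_loop (card Preds) (rank_bound_sd Preds \<Delta> \<rho>) (rank_bound_threshold Preds \<Delta> \<rho> \<beta> * dir)
      (\<lambda>t. infl p D - infl (infl_rank_inv Preds tie infl D t) D) 1 (card Preds)"
  unfolding rank_bound_def rank_bound_sd_def rank_bound_threshold_def Let_def
    rank_bound_depth_bound(2)[OF assms] by (rule refl)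

text \<open>At depth 0 the quotient \<open>\<rho> / 0\<close> is 0, and so is the deviation.\<close>

lemma rank_bound_sd_pos:
  "rank_bound_depth Preds \<noteq> 0 \<Longrightarrow> 0 < \<Delta> \<Longrightarrow> 0 < \<rho> \<Longrightarrow> 0 < rank_bound_sd Preds \<Delta> \<rho>"
  unfolding rank_bound_sd_def by (intro divide_pos_pos mult_pos_pos real_sqrt_gt_zero) auto

text \<open>The deviation is calibrated so that
  \<open>(2 * \<Delta>)\<^sup>2 / (2 * ?\<sigma>\<^sup>2)\<close> is \<open>\<rho> / ?j\<close>;
  then \<open>?j\<close> iterations together cost \<open>\<rho>\<close>.\<close>

lemma rank_bound_renyi:
  assumes "finite Preds" "linear_order_on Preds tie" "has_sensitivity Preds infl \<Delta>"
    and "neighboring D D'" "p \<in> Preds" "0 < \<rho>" "1 < \<alpha>"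
  shows "renyi_moment_le \<alpha> (exp (\<alpha> * (\<alpha> - 1) * \<rho>))
    (rank_bound Preds tie infl \<Delta> D p \<rho> \<beta> dir) (rank_bound Preds tie infl \<Delta> D' p \<rho> \<beta> dir)"
proof -
  let ?\<sigma> = "rank_bound_sd Preds \<Delta> \<rho>" and ?j = "rank_bound_depth Preds"
  have \<Delta>: "0 < \<Delta>" using assms(3) by (simp add: has_sensitivity_def)
  have ne: "Preds \<noteq> {}" using assms(5) by auto
  then have n: "1 \<le> card Preds" using assms(1) by (simp add: Suc_le_eq card_gt_0_iff)
  have "\<exists>P Q. rank_bound Preds tie infl \<Delta> D p \<rho> \<beta> dir = measure_pmf P \<and>
      rank_bound Preds tie infl \<Delta> D' p \<rho> \<beta> dir = measure_pmf Q \<and>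
      pmf_renyi_le \<alpha> (exp (?j * (\<alpha> * (\<alpha> - 1) * (2 * \<Delta>)\<^sup>2 / (2 * ?\<sigma>\<^sup>2)))) P Q"
    unfolding rank_bound_eq[OF assms(1) ne]
    using query_sensitivity[OF assms(1-5)] \<Delta> n assms rank_bound_depth_bound(1)[OF assms(1) ne]
    by (intro rank_bound_loop_renyi rank_bound_sd_pos) auto
  moreover have "?j * (\<alpha> * (\<alpha> - 1) * (2 * \<Delta>)\<^sup>2 / (2 * ?\<sigma>\<^sup>2)) \<le> \<alpha> * (\<alpha> - 1) * \<rho>"
  proof (cases "?j = 0")
    case False
    then have "?\<sigma>\<^sup>2 = (2 * \<Delta>)\<^sup>2 / (2 * (\<rho> / ?j))"
      using assms by (simp add: rank_bound_sd_def power_divide)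
    then have "(2 * \<Delta>)\<^sup>2 / (2 * ?\<sigma>\<^sup>2) = \<rho> / ?j"
      using False \<Delta> assms by simp
    then have "?j * (\<alpha> * (\<alpha> - 1) * (2 * \<Delta>)\<^sup>2 / (2 * ?\<sigma>\<^sup>2)) = ?j * (\<alpha> * (\<alpha> - 1) * (\<rho> / ?j))"
      by (metis times_divide_eq_right)
    then show ?thesis using False by simp
  qed (use assms in simp)
  ultimately obtain P Q where PQ: "rank_bound Preds tie infl \<Delta> D p \<rho> \<beta> dir = measure_pmf P"
      "rank_bound Preds tie infl \<Delta> D' p \<rho> \<beta> dir = measure_pmf Q"
      "pmf_renyi_le \<alpha> (exp (\<alpha> * (\<alpha> - 1) * \<rho>)) P Q"
    unfolding pmf_renyi_le_def by (meson exp_le_cancel_iff order_trans)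
  then show ?thesis by (simp add: renyi_moment_le_pmf)
qed

text \<open>The threshold is chosen so that the tail bound
  \<open>exp (- \<xi>\<^sup>2 / (2 * ?\<sigma>\<^sup>2))\<close> equals
  \<open>(1 - \<beta>) / ?N\<close>. Only \<open>\<xi>\<^sup>2\<close> enters this value, so both
  directions are covered.\<close>

lemma noise_exceeds_threshold_prob:
  assumes "rank_bound_depth Preds \<noteq> 0" "0 < \<Delta>" "0 < \<rho>" "0 < \<beta>" "\<beta> < 1" "A \<in> sets borel"
    and "\<xi> = rank_bound_threshold Preds \<Delta> \<rho> \<beta> \<or> \<xi> = - rank_bound_threshold Preds \<Delta> \<rho> \<beta>"
    and "\<And>z. z \<in> A \<Longrightarrow> 0 \<le> \<xi> * (z - \<xi>)"
  shows "normal_prob (rank_bound_sd Preds \<Delta> \<rho>) 0 A \<le> (1 - \<beta>) / rank_bound_depth Preds"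
proof -
  let ?\<sigma> = "rank_bound_sd Preds \<Delta> \<rho>" and ?N = "real (rank_bound_depth Preds)"
  have \<sigma>: "0 < ?\<sigma>" using assms by (intro rank_bound_sd_pos)
  have N: "1 \<le> ?N" using assms(1) by simp
  \<comment> \<open>Makes the logarithm nonnegative, so that squaring undoes the square root in the
    threshold.\<close>
  then have r: "1 \<le> ?N / (1 - \<beta>)" using assms by (simp add: field_simps)
  then have "\<xi>\<^sup>2 = ?\<sigma>\<^sup>2 * (2 * ln (?N / (1 - \<beta>)))"
    using assms(7) by (auto simp: rank_bound_threshold_def power_mult_distrib)
  then have "- \<xi>\<^sup>2 / (2 * ?\<sigma>\<^sup>2) = - ln (?N / (1 - \<beta>))"
    using \<sigma> by simp
  then have "exp (- \<xi>\<^sup>2 / (2 * ?\<sigma>\<^sup>2)) = (1 - \<beta>) / ?N"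
    using r by (simp add: exp_minus)
  then show ?thesis
    using normal_prob_tail_le[OF assms(6) \<sigma> assms(8)] by simp
qed

text \<open>Coupling: with the same centred noise, a larger mean reaches \<open>\<xi>\<close>
  whenever a smaller one does.\<close>

lemma normal_prob_mono_shift:
  assumes "0 < \<sigma>" "x \<le> y"
  shows "normal_prob \<sigma> x {\<xi>..} \<le> normal_prob \<sigma> y {\<xi>..}"
proof -
  interpret prob_space "density lborel (normal_density 0 \<sigma>)"
    by (rule prob_space_normal_density) fact
  show ?thesis
    unfolding normal_prob_eq_prob_shift[OF _ assms(1), of "{\<xi>..}", simplified, symmetric]
    using assms by (intro finite_measure_mono) auto
qed

text \<open>Invariant \<open>r \<le> hi\<close>. Only the branch that lowers \<open>hi\<close> can
  lose it, and only if \<open>t \<le> r\<close>. Then the exact query value is at most 0, so the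
  noise alone has to reach \<open>?\<xi>\<close>.\<close>

lemma rank_bound_upper:
  assumes "finite Preds" "linear_order_on Preds tie" "0 < \<Delta>" "p \<in> Preds" "0 < \<rho>" "0 < \<beta>" "\<beta> < 1"
  shows "\<exists>P. rank_bound Preds tie infl \<Delta> D p \<rho> \<beta> 1 = measure_pmf P \<and>
    \<beta> \<le> measure_pmf.prob P {infl_rank Preds tie infl D p..}"
proof -
  let ?\<sigma> = "rank_bound_sd Preds \<Delta> \<rho>" and ?j = "rank_bound_depth Preds"
  let ?\<xi> = "rank_bound_threshold Preds \<Delta> \<rho> \<beta>" and ?n = "card Preds"
  let ?d = "\<lambda>t. infl p D - infl (infl_rank_inv Preds tie infl D t) D"
  define r where "r = infl_rank Preds tie infl D p"
  note rank = infl_rank_props[OF assms(1,2,4), of infl D, folded r_def]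
  have ne: "Preds \<noteq> {}" using assms(4) by auto
  have "\<exists>P. rank_bound_loop ?n ?\<sigma> (?\<xi> * 1) ?d 1 ?n = measure_pmf P \<and>
      (r \<le> ?n \<longrightarrow> 1 - real ?j * ((1 - \<beta>) / ?j) \<le> measure_pmf.prob P {r..})"
  proof (rule rank_bound_loop_invariant[where G = "\<lambda>lo hi. r \<le> hi"])
    fix lo hi t assume \<sigma>: "0 < ?\<sigma>" and t: "r \<le> hi" "1 \<le> lo" "hi \<le> ?n" "lo \<le> t" "t < hi"
    have j: "?j \<noteq> 0" using \<sigma> by (auto simp: rank_bound_sd_def intro!: Nat.gr0I)
    have "r < t \<or> normal_prob ?\<sigma> (?d t) {?\<xi>..} \<le> (1 - \<beta>) / ?j"
    proof (cases "r < t")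
      case False
      then have "?d t \<le> 0"
        using infl_rank_inv_mono[OF assms(1,2), of t r infl D] rank t by auto
      then have "normal_prob ?\<sigma> (?d t) {?\<xi>..} \<le> normal_prob ?\<sigma> 0 {?\<xi>..}"
        using \<sigma> by (intro normal_prob_mono_shift)
      also have "\<dots> \<le> (1 - \<beta>) / ?j"
      proof (rule noise_exceeds_threshold_prob[OF j assms(3,5-7)])
        have "1 \<le> real ?j / (1 - \<beta>)" using assms j by (simp add: field_simps)
        then have "0 \<le> ?\<xi>" using \<sigma> by (simp add: rank_bound_threshold_def)
        then show "0 \<le> ?\<xi> * (z - ?\<xi>)" if "z \<in> {?\<xi>..}" for z using that by simp
      qed auto
      finally show ?thesis ..
    qed simp
    then show "(normal_prob ?\<sigma> (?d t) {?\<xi> * 1..} \<le> (1 - \<beta>) / ?j \<or> r \<le> max (t - 1) 1) \<and>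
      (1 - normal_prob ?\<sigma> (?d t) {?\<xi> * 1..} \<le> (1 - \<beta>) / ?j \<or> r \<le> hi) \<and>
      (r \<le> max (t - 1) 1 \<or> r \<le> hi)"
      using t by auto
  qed (use assms rank ne rank_bound_sd_pos rank_bound_depth_bound(1)[OF assms(1) ne] in auto)
  \<comment> \<open>An equality except at depth 0, where the right-hand side is 1.\<close>
  moreover have "\<beta> \<le> 1 - real ?j * ((1 - \<beta>) / ?j)" using assms by auto
  ultimately show ?thesis
    unfolding rank_bound_eq[OF assms(1) ne] r_def[symmetric] using rank by (auto intro: order_trans)
qed

text \<open>Invariant \<open>lo \<le> r\<close>; when the loop halts, \<open>hi \<le> lo\<close>
  turns it into \<open>hi \<le> r\<close>, so the returned upper end serves as a lower bound. Only
  the branch that raises \<open>lo\<close> can lose it, and only if \<open>r \<le> t\<close>. Then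
  the query value is at least 0, so the noise has to fall below the nonpositive
  \<open>?\<xi>\<close>.\<close>

lemma rank_bound_lower:
  assumes "finite Preds" "linear_order_on Preds tie" "0 < \<Delta>" "p \<in> Preds" "0 < \<rho>" "0 < \<beta>" "\<beta> < 1"
  shows "\<exists>P. rank_bound Preds tie infl \<Delta> D p \<rho> \<beta> (- 1) = measure_pmf P \<and>
    \<beta> \<le> measure_pmf.prob P {..infl_rank Preds tie infl D p}"
proof -
  let ?\<sigma> = "rank_bound_sd Preds \<Delta> \<rho>" and ?j = "rank_bound_depth Preds"
  let ?\<xi> = "- rank_bound_threshold Preds \<Delta> \<rho> \<beta>" and ?n = "card Preds"
  let ?d = "\<lambda>t. infl p D - infl (infl_rank_inv Preds tie infl D t) D"
  define r where "r = infl_rank Preds tie infl D p"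
  note rank = infl_rank_props[OF assms(1,2,4), of infl D, folded r_def]
  have ne: "Preds \<noteq> {}" using assms(4) by auto
  have "\<exists>P. rank_bound_loop ?n ?\<sigma> ?\<xi> ?d 1 ?n = measure_pmf P \<and>
      (1 \<le> r \<longrightarrow> 1 - real ?j * ((1 - \<beta>) / ?j) \<le> measure_pmf.prob P {..r})"
  proof (rule rank_bound_loop_invariant[where G = "\<lambda>lo hi. lo \<le> r"])
    fix lo hi t assume \<sigma>: "0 < ?\<sigma>" and t: "lo \<le> r" "1 \<le> lo" "hi \<le> ?n" "lo \<le> t" "t < hi"
    have j: "?j \<noteq> 0" using \<sigma> by (auto simp: rank_bound_sd_def intro!: Nat.gr0I)
    have "t < r \<or> 1 - normal_prob ?\<sigma> (?d t) {?\<xi>..} \<le> (1 - \<beta>) / ?j"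
    proof (cases "t < r")
      case False
      then have "0 \<le> ?d t"
        using infl_rank_inv_mono[OF assms(1,2), of r t infl D] rank t by auto
      then have "normal_prob ?\<sigma> 0 {?\<xi>..} \<le> normal_prob ?\<sigma> (?d t) {?\<xi>..}"
        using \<sigma> by (intro normal_prob_mono_shift)
      moreover have "normal_prob ?\<sigma> 0 (- {?\<xi>..}) \<le> (1 - \<beta>) / ?j"
      proof (rule noise_exceeds_threshold_prob[OF j assms(3,5-7)])
        have "1 \<le> real ?j / (1 - \<beta>)" using assms j by (simp add: field_simps)
        then have "?\<xi> \<le> 0" using \<sigma> by (simp add: rank_bound_threshold_def)
        then show "0 \<le> ?\<xi> * (z - ?\<xi>)" if "z \<in> - {?\<xi>..}" for z
          using that by (intro mult_nonpos_nonpos) auto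
      qed auto
      ultimately show ?thesis
        using normal_prob_Compl[OF _ \<sigma>, of "{?\<xi>..}" 0] by (simp del: Compl_atLeast)
    qed simp
    then show "(normal_prob ?\<sigma> (?d t) {?\<xi>..} \<le> (1 - \<beta>) / ?j \<or> lo \<le> r) \<and>
      (1 - normal_prob ?\<sigma> (?d t) {?\<xi>..} \<le> (1 - \<beta>) / ?j \<or> min (t + 1) ?n \<le> r) \<and>
      (lo \<le> r \<or> min (t + 1) ?n \<le> r)"
      using t by auto
  qed (use assms rank ne rank_bound_sd_pos rank_bound_depth_bound(1)[OF assms(1) ne] in auto)
  moreover have "\<beta> \<le> 1 - real ?j * ((1 - \<beta>) / ?j)" using assms by auto
  ultimately show ?thesis
    unfolding rank_bound_eq[OF assms(1) ne] r_def[symmetric] using rank by (auto intro: order_trans)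
qed

text \<open>The invariant \<open>False\<close> reduces \<open>rank_bound_loop_invariant\<close> to
  the existence of a discrete distribution, for any direction and level.\<close>

lemma rank_bound_pmf:
  assumes "finite Preds" "Preds \<noteq> {}" "0 < \<Delta>" "0 < \<rho>"
  shows "\<exists>P. rank_bound Preds tie infl \<Delta> D p \<rho> \<beta> dir = measure_pmf P"
proof -
  have "\<exists>P. rank_bound_loop (card Preds) (rank_bound_sd Preds \<Delta> \<rho>) (rank_bound_threshold Preds \<Delta> \<rho> \<beta> * dir)
      (\<lambda>t. infl p D - infl (infl_rank_inv Preds tie infl D t) D) 1 (card Preds) = measure_pmf P \<and>
      (False \<longrightarrow> 1 - real (rank_bound_depth Preds) * 0 \<le> measure_pmf.prob P {})"
    using assms rank_bound_sd_pos rank_bound_depth_bound(1)[OF assms(1,2)]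
    by (intro rank_bound_loop_invariant[where G = "\<lambda>_ _. False"]) auto
  then show ?thesis unfolding rank_bound_eq[OF assms(1,2)] by blast
qed

lemma prob_space_pair_measure:
  assumes "prob_space M" "prob_space N"
  shows "prob_space (M \<Otimes>\<^sub>M N)"
proof -
  interpret pair_prob_space M N
    using assms by (intro pair_prob_space.intro pair_sigma_finite.intro prob_space_imp_sigma_finite)
  show ?thesis by (rule prob_space_axioms)
qed

lemma rank_bound_prob:
  assumes "finite Preds" "Preds \<noteq> {}" "0 < \<Delta>" "0 < \<rho>"
  shows "prob_space (rank_bound Preds tie infl \<Delta> D p \<rho> \<beta> dir)"
    "sets (rank_bound Preds tie infl \<Delta> D p \<rho> \<beta> dir) = UNIV"
proof -
  obtain P where "rank_bound Preds tie infl \<Delta> D p \<rho> \<beta> dir = measure_pmf P"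
    using rank_bound_pmf[OF assms] by blast
  then show "prob_space (rank_bound Preds tie infl \<Delta> D p \<rho> \<beta> dir)"
    "sets (rank_bound Preds tie infl \<Delta> D p \<rho> \<beta> dir) = UNIV"
    by (simp_all add: prob_space_measure_pmf)
qed

text \<open>Independence makes the probability a product, and a product of two numbers in the unit
  interval is at least their sum minus 1.\<close>

lemma prob_pair_interval_ge:
  fixes P Q :: "nat pmf"
  assumes "\<beta> \<le> measure_pmf.prob P {..r}" "\<beta> \<le> measure_pmf.prob Q {r..}"
  shows "2 * \<beta> - 1 \<le> \<P>(x in measure_pmf P \<Otimes>\<^sub>M measure_pmf Q. fst x \<le> r \<and> r \<le> snd x)"
proof -
  interpret P: prob_space P by (rule prob_space_measure_pmf)
  interpret Q: prob_space Q by (rule prob_space_measure_pmf)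
  interpret PQ: pair_prob_space P Q ..
  have "{x \<in> space (measure_pmf P \<Otimes>\<^sub>M measure_pmf Q). fst x \<le> r \<and> r \<le> snd x} = {..r} \<times> {r..}"
    by (auto simp: space_pair_measure)
  then have "\<P>(x in measure_pmf P \<Otimes>\<^sub>M measure_pmf Q. fst x \<le> r \<and> r \<le> snd x)
      = measure P {..r} * measure Q {r..}"
    by (simp add: measure_def measure_pmf.emeasure_pair_measure_Times enn2real_mult)
  moreover have "0 \<le> (1 - measure P {..r}) * (1 - measure Q {r..})"
    by (intro mult_nonneg_nonneg) auto
  ultimately show ?thesis using assms by (simp add: algebra_simps)
qed

section \<open>The mechanism\<close>

theorem theorem4p10:
  fixes Preds :: "'p set" and tie :: "'p rel"
    and infl :: "'p \<Rightarrow> 'a multiset \<Rightarrow> real"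
    and \<Delta> \<eta> \<gamma> \<rho>_rank :: real and k :: nat and p :: "nat \<Rightarrow> 'p"
  assumes "finite Preds" and "linear_order_on Preds tie"
    and "has_sensitivity Preds infl \<Delta>"
    and "1 \<le> k" and "\<forall>u\<in>{1..k}. p u \<in> Preds"
    and "0 < \<eta>" and "\<eta> < 1"
    and "0 < \<gamma>" and "\<gamma> < 1" and "0 < \<rho>_rank"
  shows "zCDP (interval_space k) \<rho>_rank (noisy_binary_search Preds tie infl \<Delta> \<eta> k p \<gamma> \<rho>_rank)
    \<and> (\<forall>D. \<forall>u\<in>{1..k}.
          \<gamma> \<le> \<P>(I in noisy_binary_search Preds tie infl \<Delta> \<eta> k p \<gamma> \<rho>_rank D.
                 fst (I u) \<le> infl_rank Preds tie infl D (p u) \<and> infl_rank Preds tie infl D (p u) \<le> snd (I u)))"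
proof -
  define \<rho> \<beta> where "\<rho> = \<rho>_rank / k" and "\<beta> = (\<gamma> + 1) / 2"
  have \<Delta>: "0 < \<Delta>" using assms(3) by (simp add: has_sensitivity_def)
  have ne: "Preds \<noteq> {}" using assms(4,5) by force
  have \<rho>: "0 < \<rho>" "0 < \<eta> * \<rho>" "0 < (1 - \<eta>) * \<rho>" using assms by (auto simp: \<rho>_def)
  have \<beta>: "0 < \<beta>" "\<beta> < 1" using assms by (auto simp: \<beta>_def)
  define L where "L D u = rank_bound Preds tie infl \<Delta> D (p u) (\<eta> * \<rho>) \<beta> (- 1)" for D u
  define U where "U D u = rank_bound Preds tie infl \<Delta> D (p u) ((1 - \<eta>) * \<rho>) \<beta> 1" for D u
  have mech: "noisy_binary_search Preds tie infl \<Delta> \<eta> k p \<gamma> \<rho>_rank D = PiM {1..k} (\<lambda>u. L D u \<Otimes>\<^sub>M U D u)" for D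
    unfolding noisy_binary_search_def Let_def L_def U_def \<rho>_def \<beta>_def by (rule refl)
  have prob: "prob_space (L D u)" "prob_space (U D u)" for D u
    using rank_bound_prob(1)[OF assms(1) ne \<Delta>] \<rho> unfolding L_def U_def by blast+
  have prob_LU: "prob_space (L D u \<Otimes>\<^sub>M U D u)" for D u
    using prob by (intro prob_space_pair_measure)
  have sets: "sets (L D u) = UNIV" "sets (U D u) = UNIV" for D u
    using rank_bound_prob(2)[OF assms(1) ne \<Delta>] \<rho> unfolding L_def U_def by blast+
  have in_space: "PiM {1..k} (\<lambda>u. L D u \<Otimes>\<^sub>M U D u) \<in> space (prob_algebra (interval_space k))" for D
    unfolding space_prob_algebra interval_space_def using prob_LU
    by (auto intro!: prob_space_PiM sets_PiM_cong sets_pair_measure_cong simp: sets)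
  have "renyi_divergence \<alpha> (PiM {1..k} (\<lambda>u. L D u \<Otimes>\<^sub>M U D u)) (PiM {1..k} (\<lambda>u. L D' u \<Otimes>\<^sub>M U D' u))
      \<le> ereal (\<rho>_rank * \<alpha>)" if "neighboring D D'" "1 < \<alpha>" for D D' \<alpha>
  proof (rule renyi_divergence_le)
    let ?C = "\<lambda>u :: nat. exp (\<alpha> * (\<alpha> - 1) * (\<eta> * \<rho>)) * exp (\<alpha> * (\<alpha> - 1) * ((1 - \<eta>) * \<rho>))"
    have "renyi_moment_le \<alpha> (\<Prod>u\<in>{1..k}. ?C u)
        (PiM {1..k} (\<lambda>u. L D u \<Otimes>\<^sub>M U D u)) (PiM {1..k} (\<lambda>u. L D' u \<Otimes>\<^sub>M U D' u))"
    proof (intro renyi_moment_le_PiM renyi_moment_le_pair prob prob_LU)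
      fix u assume "u \<in> {1..k}"
      then have "p u \<in> Preds" using assms(5) by simp
      then show "renyi_moment_le \<alpha> (exp (\<alpha> * (\<alpha> - 1) * (\<eta> * \<rho>))) (L D u) (L D' u)"
        "renyi_moment_le \<alpha> (exp (\<alpha> * (\<alpha> - 1) * ((1 - \<eta>) * \<rho>))) (U D u) (U D' u)"
        unfolding L_def U_def using that \<rho> by (auto intro!: rank_bound_renyi assms(1-3))
    qed auto
    \<comment> \<open>The shares \<open>\<eta>\<close> and \<open>1 - \<eta>\<close> add up to
      \<open>\<rho>\<close> for each pair, and the \<open>k\<close> pairs to
      \<open>k * \<rho> = \<rho>_rank\<close>.\<close>
    also have "(\<Prod>u\<in>{1..k}. ?C u) = exp (k * (\<alpha> * (\<alpha> - 1) * (\<eta> * \<rho>) + \<alpha> * (\<alpha> - 1) * ((1 - \<eta>) * \<rho>)))"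
      by (simp only: exp_add[symmetric] prod_constant card_atLeastAtMost exp_of_nat_mult) simp
    also have "k * (\<alpha> * (\<alpha> - 1) * (\<eta> * \<rho>) + \<alpha> * (\<alpha> - 1) * ((1 - \<eta>) * \<rho>)) = (\<alpha> - 1) * \<alpha> * (k * \<rho>)"
      by (simp add: algebra_simps)
    also have "k * \<rho> = \<rho>_rank" using assms(4) by (simp add: \<rho>_def)
    finally show "renyi_moment_le \<alpha> (exp ((\<alpha> - 1) * (\<rho>_rank * \<alpha>)))
        (PiM {1..k} (\<lambda>u. L D u \<Otimes>\<^sub>M U D u)) (PiM {1..k} (\<lambda>u. L D' u \<Otimes>\<^sub>M U D' u))"
      by (simp add: mult_ac)
  qed (use that assms prob_LU in \<open>auto intro!: prob_space_PiM\<close>)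
  then have zCDP: "zCDP (interval_space k) \<rho>_rank (noisy_binary_search Preds tie infl \<Delta> \<eta> k p \<gamma> \<rho>_rank)"
    unfolding zCDP_def mech using in_space by blast
  have conf: "\<gamma> \<le> \<P>(I in noisy_binary_search Preds tie infl \<Delta> \<eta> k p \<gamma> \<rho>_rank D.
      fst (I u) \<le> infl_rank Preds tie infl D (p u) \<and> infl_rank Preds tie infl D (p u) \<le> snd (I u))"
    if u: "u \<in> {1..k}" for D u
  proof -
    define r where "r = infl_rank Preds tie infl D (p u)"
    let ?M = "PiM {1..k} (\<lambda>u. L D u \<Otimes>\<^sub>M U D u)" and ?N = "L D u \<Otimes>\<^sub>M U D u"
    have pu: "p u \<in> Preds" using u assms(5) by simp
    obtain P where P: "L D u = measure_pmf P" "\<beta> \<le> measure_pmf.prob P {..r}"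
      using rank_bound_lower[OF assms(1,2) \<Delta> pu \<rho>(2) \<beta>] unfolding L_def r_def by blast
    obtain Q where Q: "U D u = measure_pmf Q" "\<beta> \<le> measure_pmf.prob Q {r..}"
      using rank_bound_upper[OF assms(1,2) \<Delta> pu \<rho>(3) \<beta>] unfolding U_def r_def by blast
    let ?A = "{x \<in> space ?N. fst x \<le> r \<and> r \<le> snd x}"
    have "?A = {..r} \<times> {r..}" by (auto simp: space_pair_measure P Q)
    then have A: "?A \<in> sets ?N" by (auto simp: P Q)
    \<comment> \<open>The choice of \<open>\<beta>\<close> allots half of the failure probability
      \<open>1 - \<gamma>\<close> to each endpoint.\<close>
    have "\<gamma> \<le> 2 * \<beta> - 1" by (simp add: \<beta>_def field_simps)
    also have "\<dots> \<le> measure ?N ?A"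
      using prob_pair_interval_ge[OF P(2) Q(2)] by (simp add: P Q)
    \<comment> \<open>The event concerns coordinate \<open>u\<close> only, and the corresponding
      marginal of the product is \<open>?N\<close> because all factors are probability
      measures.\<close>
    also have "\<dots> = measure (distr ?M ?N (\<lambda>I. I u)) ?A"
      using distr_PiM_component[of "{1..k}" "\<lambda>u. L D u \<Otimes>\<^sub>M U D u" u] prob_LU u by simp
    also have "\<dots> = measure ?M ((\<lambda>I. I u) -` ?A \<inter> space ?M)"
      using A u by (intro measure_distr) auto
    also have "(\<lambda>I. I u) -` ?A \<inter> space ?M = {I \<in> space ?M. fst (I u) \<le> r \<and> r \<le> snd (I u)}"
      using u by (auto simp: space_PiM)
    finally show ?thesis unfolding r_def mech .
  qed
  show ?thesis by (intro conjI allI ballI zCDP conf)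
qed

end
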